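(* There is an absolute constant $C > 0$ such that for each $1 \leq p \leq \infty$ and all positive integers $n$, $$\frac{1}{C} \Big( \frac{\log n}{n} \Big)^{1-\frac{1}{\min (p,2)}} \leq K(B_{\ell_p^n}) .$$
   Context: $\ell_p^n$ is $\mathbb{C}^n$ with the $p$-norm $\|z\|_p=(\sum_k|z_k|^p)^{1/p}$ (maximum norm for $p=\infty$), and $B_{\ell_p^n}$ is its open unit ball. For a Banach space $X=(\mathbb{C}^n,\|\cdot\|)$ whose unit ball is a Reinhardt domain, the Bohr radius $K(B_X)$ of its open unit ball is the supremum of all $r\ge 0$ such that for each holomorphic function $f=\sum_{\alpha\in\mathbb{N}_0^n} a_\alpha z^\alpha$ on $B_X$ (monomial expansion) one has $$\sup_{z\in rB_X}\sum_\alpha|a_\alpha z^\alpha|\le\sup_{z\in B_X}\Big|\sum_\alpha a_\alpha z^\alpha\Big| .$$ *)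

theory Defs
  imports "HOL-Analysis.Analysis"
begin

text \<open>
  The dimension \<open>n\<close> is quantified inside the statement, so it cannot be a type: \<open>\<complex>\<^sup>n\<close> is the set of
  sequences vanishing from index \<open>n\<close> on, with coordinates indexed by \<open>0, \<dots>, n - 1\<close>. A Banach space
  \<open>X = (\<complex>\<^sup>n, \<parallel>\<cdot>\<parallel>)\<close> is given by \<open>n\<close> and its norm \<open>N\<close>.
\<close>

definition cspace :: "nat \<Rightarrow> (nat \<Rightarrow> complex) set" where
  "cspace n = {z. \<forall>k\<ge>n. z k = 0}"

definition multi_indices :: "nat \<Rightarrow> (nat \<Rightarrow> nat) set" where
  "multi_indices n = {\<alpha>. \<forall>k\<ge>n. \<alpha> k = 0}"

definition monomial :: "nat \<Rightarrow> (nat \<Rightarrow> nat) \<Rightarrow> (nat \<Rightarrow> complex) \<Rightarrow> complex" where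
  "monomial n \<alpha> z = (\<Prod>k<n. z k ^ \<alpha> k)"

definition lp_norm :: "ereal \<Rightarrow> nat \<Rightarrow> (nat \<Rightarrow> complex) \<Rightarrow> real" where
  "lp_norm p n z =
     (if p = \<infinity> then Max ((\<lambda>k. cmod (z k)) ` {..<n})
      else (\<Sum>k<n. cmod (z k) powr real_of_ereal p) powr (1 / real_of_ereal p))"

definition unit_ball :: "nat \<Rightarrow> ((nat \<Rightarrow> complex) \<Rightarrow> real) \<Rightarrow> (nat \<Rightarrow> complex) set" where
  "unit_ball n N = {z \<in> cspace n. N z < 1}"

text \<open>
  Holomorphy on an open set \<open>U \<subseteq> \<complex>\<^sup>n\<close>: complex Frechet differentiability at every point of \<open>U\<close>, the
  derivative being the \<open>\<complex>\<close>-linear form with coefficients \<open>c\<close>.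
\<close>

definition holomorphic_Cn ::
    "nat \<Rightarrow> ((nat \<Rightarrow> complex) \<Rightarrow> real) \<Rightarrow> ((nat \<Rightarrow> complex) \<Rightarrow> complex) \<Rightarrow> (nat \<Rightarrow> complex) set \<Rightarrow> bool" where
  "holomorphic_Cn n N f U \<longleftrightarrow>
     (\<forall>z\<in>U. \<exists>c :: nat \<Rightarrow> complex. \<forall>e>0. \<exists>d>0. \<forall>h\<in>cspace n.
        N h < d \<and> (\<lambda>k. z k + h k) \<in> U \<longrightarrow>
        cmod (f (\<lambda>k. z k + h k) - f z - (\<Sum>k<n. c k * h k)) \<le> e * N h)"

definition monomial_expansion ::
    "nat \<Rightarrow> ((nat \<Rightarrow> nat) \<Rightarrow> complex) \<Rightarrow> ((nat \<Rightarrow> complex) \<Rightarrow> complex) \<Rightarrow> (nat \<Rightarrow> complex) set \<Rightarrow> bool" where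
  "monomial_expansion n a f U \<longleftrightarrow>
     (\<forall>z\<in>U. ((\<lambda>\<alpha>. a \<alpha> * monomial n \<alpha> z) has_sum f z) (multi_indices n))"

text \<open>
  The two sides of the Bohr inequality may be infinite (\<open>f\<close> may be unbounded on the ball), hence
  the suprema and the sum of absolute values are taken in \<open>ennreal\<close>. On a Reinhardt unit ball every
  holomorphic \<open>f\<close> has exactly one monomial expansion. The outer supremum is real: for
  \<open>n \<ge> 1\<close> taking a coordinate function for \<open>f\<close> forces \<open>r \<le> 1\<close>.
\<close>

definition bohr_radius :: "nat \<Rightarrow> ((nat \<Rightarrow> complex) \<Rightarrow> real) \<Rightarrow> real" where
  "bohr_radius n N = Sup {r. 0 \<le> r \<and>
     (\<forall>f a. holomorphic_Cn n N f (unit_ball n N) \<and> monomial_expansion n a f (unit_ball n N) \<longrightarrow>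
        (SUP z\<in>(\<lambda>z k. of_real r * z k) ` unit_ball n N.
           \<Sum>\<^sub>\<infinity>\<alpha>\<in>multi_indices n. ennreal (cmod (a \<alpha> * monomial n \<alpha> z)))
        \<le> (SUP z\<in>unit_ball n N. ennreal (cmod (f z))))}"

text \<open>
  Real powers of nonnegative bases with \<open>0\<^sup>0 = 1\<close>, whereas \<open>0 powr 0 = 0\<close>. This matters
  for \<open>n = 1\<close>, \<open>p = 1\<close>, where the base \<open>ln n / n\<close> and the exponent both vanish.
\<close>

definition rpow :: "real \<Rightarrow> real \<Rightarrow> real" where
  "rpow x s = (if s = 0 then 1 else x powr s)"

end

theory Submission
  imports Defs "HOL-Complex_Analysis.Cauchy_Integral_Formula"
begin

text \<open>
  Let \<open>P = \<Sum> c\<^sub>\<alpha> z\<^sup>\<alpha>\<close> be homogeneous of degree \<open>m\<close> and bounded by \<open>S\<close> on the ball, let \<open>H\<close> be the set of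
  multi-indices of degree \<open>m - 1\<close>, and \<open>\<sigma> = 1 - 1 / min p 2\<close>. The key estimate is
  \<open>\<Sum> |c\<^sub>\<alpha> u\<^sup>\<alpha>| \<le> e\<^sup>m |H|\<^sup>\<sigma> S\<close> for \<open>u\<close> in the ball; that \<open>m\<close> is replaced by \<open>m - 1\<close> in \<open>H\<close> is what
  produces the logarithm. One differentiates once: \<open>\<Sum> w\<^sub>k \<partial>\<^sub>k P(z)\<close> is at most \<open>e m S\<close> by Cauchy's
  inequality for \<open>t \<mapsto> P(z + t w)\<close> on \<open>|t| = 1/m\<close>, and by Euler's identity the coefficients of the
  \<open>\<partial>\<^sub>k P\<close> control \<open>m\<close> times those of \<open>P\<close>. If \<open>p \<ge> 2\<close>, replace \<open>P\<close> by \<open>z \<mapsto> P(u z)\<close> on the polydisc,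
  use the hypercontractive bound \<open>\<parallel>\<partial>\<^sub>k P\<parallel>\<^sub>2 \<le> 2\<^bsup>m-1\<^esup> \<parallel>\<partial>\<^sub>k P\<parallel>\<^sub>1\<close> on the torus, sum over \<open>k\<close>, and apply
  Cauchy-Schwarz over \<open>H\<close>. If \<open>p \<le> 2\<close>, estimate each Taylor coefficient of \<open>\<Sum> w\<^sub>k \<partial>\<^sub>k P\<close> at an optimal
  point of the \<open>p\<close>-sphere and apply the power mean inequality over \<open>H\<close>.

  A generating function bound gives \<open>(log n / n)\<^sup>m |H| \<le> 4\<^sup>m\<close>. Caratheodory's inequality bounds the
  \<open>m\<close>-homogeneous part of \<open>f\<close> by \<open>2 (sup |f| - |f(0)|)\<close>, and the Bohr inequality follows by summing a
  geometric series. All means over tori are finite averages over roots of unity.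
\<close>

section \<open>Homogeneous polynomials\<close>

definition hom_indices :: "nat \<Rightarrow> nat \<Rightarrow> (nat \<Rightarrow> nat) set" where
  "hom_indices n m = {\<alpha> \<in> multi_indices n. (\<Sum>k<n. \<alpha> k) = m}"

definition hpoly :: "nat \<Rightarrow> nat \<Rightarrow> ((nat \<Rightarrow> nat) \<Rightarrow> complex) \<Rightarrow> (nat \<Rightarrow> complex) \<Rightarrow> complex" where
  "hpoly n m c z = (\<Sum>\<alpha>\<in>hom_indices n m. c \<alpha> * monomial n \<alpha> z)"

text \<open>The coefficient at \<open>\<beta>\<close> of the k-th partial derivative of the
  polynomial with coefficients \<open>c\<close>.\<close>

definition deriv_coeff ::
    "nat \<Rightarrow> ((nat \<Rightarrow> nat) \<Rightarrow> complex) \<Rightarrow> (nat \<Rightarrow> nat) \<Rightarrow> complex" where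
  "deriv_coeff k c \<beta> = of_nat (Suc (\<beta> k)) * c (\<beta>(k := Suc (\<beta> k)))"

lemma hom_indices_le: "\<alpha> \<in> hom_indices n m \<Longrightarrow> \<alpha> k \<le> m"
proof (cases "k < n")
  case True
  assume "\<alpha> \<in> hom_indices n m"
  then show ?thesis
    using member_le_sum[of k "{..<n}" \<alpha>] True by (auto simp: hom_indices_def)
qed (auto simp: hom_indices_def multi_indices_def)

lemma finite_hom_indices [simp]: "finite (hom_indices n m)"
proof (rule finite_subset)
  show "hom_indices n m \<subseteq>
      {f. \<forall>x. (x \<in> {..<n} \<longrightarrow> f x \<in> {..m}) \<and> (x \<notin> {..<n} \<longrightarrow> f x = 0)}"
    using hom_indices_le by (auto simp: hom_indices_def multi_indices_def)
  show "finite {f. \<forall>x. (x \<in> {..<n} \<longrightarrow> f x \<in> {..m}) \<and> (x \<notin> {..<n} \<longrightarrow> f x = (0::nat))}"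
    by (rule finite_set_of_finite_funs) auto
qed

lemma hom_indices_subset: "hom_indices n m \<subseteq> multi_indices n"
  by (auto simp: hom_indices_def)

lemma hom_indices_0: "hom_indices n 0 = {\<lambda>_. 0}"
  by (auto simp: hom_indices_def multi_indices_def fun_eq_iff) (metis lessThan_iff not_le)

lemma monomial_mult: "monomial n \<alpha> (\<lambda>k. u k * v k) = monomial n \<alpha> u * monomial n \<alpha> v"
  by (simp add: monomial_def power_mult_distrib prod.distrib)

lemma monomial_scale:
  assumes "\<alpha> \<in> hom_indices n m"
  shows "monomial n \<alpha> (\<lambda>k. t * z k) = t ^ m * monomial n \<alpha> z"
  using assms
  by (auto simp: monomial_def hom_indices_def power_mult_distrib prod.distrib simp flip: power_sum)

lemma monomial_cong: "(\<And>k. k < n \<Longrightarrow> z k = w k) \<Longrightarrow> monomial n \<alpha> z = monomial n \<alpha> w"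
  by (simp add: monomial_def)

lemma hpoly_cong: "(\<And>k. k < n \<Longrightarrow> z k = w k) \<Longrightarrow> hpoly n m c z = hpoly n m c w"
  unfolding hpoly_def by (intro sum.cong refl arg_cong2[where f="(*)"] monomial_cong) auto

lemma hpoly_scale: "hpoly n m c (\<lambda>k. t * z k) = t ^ m * hpoly n m c z"
  by (simp add: hpoly_def monomial_scale sum_distrib_left mult_ac)

lemma cmod_monomial: "cmod (monomial n \<alpha> z) = (\<Prod>k<n. cmod (z k) ^ \<alpha> k)"
  by (simp add: monomial_def prod_norm [symmetric] norm_power)

text \<open>Adding 1 to entry \<open>k\<close> maps the multi-indices of degree \<open>q\<close>
  bijectively onto those of degree \<open>q + 1\<close> with nonzero entry \<open>k\<close>; the
  weight \<open>\<alpha> k\<close> kills all others.\<close>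

lemma hom_indices_reindex:
  fixes g :: "(nat \<Rightarrow> nat) \<Rightarrow> 'a::comm_semiring_1"
  assumes "k < n"
  shows "(\<Sum>\<alpha>\<in>hom_indices n (Suc q). of_nat (\<alpha> k) * g \<alpha>) =
         (\<Sum>\<beta>\<in>hom_indices n q. of_nat (Suc (\<beta> k)) * g (\<beta>(k := Suc (\<beta> k))))"
proof -
  let ?A = "{\<alpha> \<in> hom_indices n (Suc q). \<alpha> k \<noteq> 0}"
  have sum_upd: "(\<Sum>i<n. (\<beta>(k := x)) i) + \<beta> k = (\<Sum>i<n. \<beta> i) + x" for \<beta> :: "nat \<Rightarrow> nat" and x
  proof -
    have "(\<Sum>i<n. (\<beta>(k := x)) i) = x + (\<Sum>i\<in>{..<n} - {k}. \<beta> i)"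
      using assms by (subst sum.remove[of _ k]) (auto intro!: sum.cong)
    moreover have "(\<Sum>i<n. \<beta> i) = \<beta> k + (\<Sum>i\<in>{..<n} - {k}. \<beta> i)"
      using assms by (subst sum.remove[of _ k]) auto
    ultimately show ?thesis by simp
  qed
  have up: "\<beta>(k := Suc (\<beta> k)) \<in> ?A" if "\<beta> \<in> hom_indices n q" for \<beta>
    using that assms sum_upd[of \<beta> "Suc (\<beta> k)"] by (auto simp: hom_indices_def multi_indices_def)
  have down: "\<alpha>(k := \<alpha> k - 1) \<in> hom_indices n q" if "\<alpha> \<in> ?A" for \<alpha>
    using that assms sum_upd[of \<alpha> "\<alpha> k - 1"] by (auto simp: hom_indices_def multi_indices_def)
  have "(\<Sum>\<alpha>\<in>hom_indices n (Suc q). of_nat (\<alpha> k) * g \<alpha>) = (\<Sum>\<alpha>\<in>?A. of_nat (\<alpha> k) * g \<alpha>)"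
    by (rule sum.mono_neutral_right) auto
  also have "\<dots> = (\<Sum>\<beta>\<in>hom_indices n q. of_nat (Suc (\<beta> k)) * g (\<beta>(k := Suc (\<beta> k))))"
    by (rule sum.reindex_bij_witness[where j="\<lambda>\<alpha>. \<alpha>(k := \<alpha> k - 1)" and i="\<lambda>\<beta>. \<beta>(k := Suc (\<beta> k))"])
       (use up down in auto)
  finally show ?thesis .
qed

text \<open>Multiplied out, the product is a nonnegative sum over all exponent vectors with entries
  up to \<open>q\<close>, and those of degree \<open>q\<close> are among them.
  \<open>restrict\<close> only changes the encoding: functions in \<open>PiE\<close> are
  \<open>undefined\<close> off the index set, multi-indices are 0 there.\<close>

lemma sum_hom_indices_prod_le:
  fixes g :: "nat \<Rightarrow> nat \<Rightarrow> real"
  assumes "\<And>k i. k < n \<Longrightarrow> 0 \<le> g k i"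
  shows "(\<Sum>\<alpha>\<in>hom_indices n q. \<Prod>k<n. g k (\<alpha> k)) \<le> (\<Prod>k<n. \<Sum>i\<le>q. g k i)"
proof -
  let ?r = "\<lambda>\<alpha>::nat \<Rightarrow> nat. restrict \<alpha> {..<n}"
  have inj: "inj_on ?r (hom_indices n q)"
  proof (rule inj_onI)
    fix \<alpha> \<beta> assume *: "\<alpha> \<in> hom_indices n q" "\<beta> \<in> hom_indices n q" "?r \<alpha> = ?r \<beta>"
    show "\<alpha> = \<beta>"
    proof
      fix k show "\<alpha> k = \<beta> k"
        using *(1,2) fun_cong[OF *(3), of k]
        by (cases "k < n") (simp_all add: hom_indices_def multi_indices_def)
    qed
  qed
  have "(\<Sum>\<alpha>\<in>hom_indices n q. \<Prod>k<n. g k (\<alpha> k)) = (\<Sum>\<alpha>\<in>?r ` hom_indices n q. \<Prod>k<n. g k (\<alpha> k))"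
    by (simp add: sum.reindex[OF inj])
  also have "\<dots> \<le> (\<Sum>\<alpha>\<in>PiE {..<n} (\<lambda>_. {..q}). \<Prod>k<n. g k (\<alpha> k))"
    by (rule sum_mono2)
       (use hom_indices_le in \<open>auto intro!: prod_nonneg assms finite_PiE split: if_splits\<close>)
  also have "\<dots> = (\<Prod>k<n. \<Sum>i\<le>q. g k i)"
    by (rule prod_sum_PiE[symmetric]) auto
  finally show ?thesis .
qed

section \<open>Averages over roots of unity\<close>

text \<open>Serves to align phases, also at 0, where \<open>sgn\<close> vanishes.\<close>

lemma cnj_sgn_mult: "cnj (sgn x) * x = complex_of_real (cmod x)"
  by (simp add: sgn_eq complex_norm_square[symmetric] power2_eq_square mult.commute[of "cnj _"]
      divide_simps)

definition root_pt :: "nat \<Rightarrow> nat \<Rightarrow> complex" where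
  "root_pt N j = exp (2 * of_real pi * \<i> * of_nat j / of_nat N)"

lemma cmod_root_pt [simp]: "cmod (root_pt N j) = 1"
proof -
  have "2 * of_real pi * \<i> * of_nat j / of_nat N = \<i> * of_real (2 * pi * real j / real N)" by simp
  then show ?thesis unfolding root_pt_def by (simp only: norm_exp_i_times)
qed

text \<open>The exponent is symmetric in \<open>j\<close> and \<open>a\<close>; sums of powers over
  \<open>j\<close> thus become geometric series.\<close>

lemma root_pt_power: "root_pt N j ^ a = root_pt N a ^ j"
  by (simp add: root_pt_def exp_of_nat_mult[symmetric] mult_ac)

lemma root_pt_mult_cnj: "root_pt N a * cnj (root_pt N a) = 1"
  by (simp add: complex_norm_square[symmetric])

lemma sum_root_pt:
  assumes "a < N" "b < N"
  shows "(\<Sum>j<N. root_pt N j ^ a * cnj (root_pt N j ^ b)) = (if a = b then of_nat N else 0)"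
proof -
  let ?x = "root_pt N a * cnj (root_pt N b)"
  have N: "1 \<le> N" using assms by simp
  have one: "root_pt N a ^ N = 1" for a
  proof -
    have "root_pt N a ^ N = root_pt N N ^ a" by (rule root_pt_power)
    also have "root_pt N N = 1" using N by (simp add: root_pt_def)
    finally show ?thesis by simp
  qed
  have eq: "root_pt N j ^ a * cnj (root_pt N j ^ b) = ?x ^ j" for j
    by (simp only: root_pt_power[of N j] power_mult_distrib complex_cnj_power)
  show ?thesis
  proof (cases "a = b")
    case True
    then show ?thesis unfolding eq by (simp add: root_pt_mult_cnj)
  next
    case False
    \<comment> \<open>Both indices lie below \<open>N\<close>, so distinct ones give distinct roots
      of unity.\<close>
    have "?x \<noteq> 1"
    proof
      assume "?x = 1"
      then have "root_pt N a = root_pt N b"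
        by (metis mult.assoc mult.commute mult.right_neutral root_pt_mult_cnj)
      then show False using complex_root_unity_eq[OF N, of a b] assms False by (simp add: root_pt_def)
    qed
    moreover have "?x ^ N = 1" by (simp add: power_mult_distrib one flip: complex_cnj_power)
    ultimately show ?thesis unfolding eq using False by (simp add: sum_gp_strict)
  qed
qed

text \<open>Indexes the n-tuples of N-th roots of unity. Monomials are exactly orthogonal on them as
  long as all exponents stay below \<open>N\<close>.\<close>

definition grid :: "nat \<Rightarrow> nat \<Rightarrow> (nat \<Rightarrow> nat) set" where
  "grid n N = PiE {..<n} (\<lambda>_. {..<N})"

definition torus_pt :: "nat \<Rightarrow> (nat \<Rightarrow> nat) \<Rightarrow> nat \<Rightarrow> complex" where
  "torus_pt N j k = root_pt N (j k)"

lemma finite_grid [simp]: "finite (grid n N)"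
  unfolding grid_def by (rule finite_PiE) auto

lemma card_grid: "card (grid n N) = N ^ n"
  unfolding grid_def by (simp add: card_PiE)

lemma cmod_torus_pt [simp]: "cmod (torus_pt N j k) = 1"
  by (simp add: torus_pt_def)

lemma torus_orthogonal:
  assumes "\<alpha> \<in> multi_indices n" "\<beta> \<in> multi_indices n" "\<And>k. \<alpha> k < N" "\<And>k. \<beta> k < N"
  shows "(\<Sum>j\<in>grid n N. monomial n \<alpha> (torus_pt N j) * cnj (monomial n \<beta> (torus_pt N j)))
       = (if \<alpha> = \<beta> then of_nat (N ^ n) else 0)"
proof -
  have "(\<Sum>j\<in>grid n N. monomial n \<alpha> (torus_pt N j) * cnj (monomial n \<beta> (torus_pt N j)))
      = (\<Sum>j\<in>grid n N. \<Prod>k<n. root_pt N (j k) ^ \<alpha> k * cnj (root_pt N (j k) ^ \<beta> k))"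
    by (simp add: monomial_def torus_pt_def prod.distrib cnj_prod)
  also have "\<dots> = (\<Prod>k<n. \<Sum>j<N. root_pt N j ^ \<alpha> k * cnj (root_pt N j ^ \<beta> k))"
    unfolding grid_def by (rule prod_sum_PiE[symmetric]) auto
  also have "\<dots> = (\<Prod>k<n. if \<alpha> k = \<beta> k then of_nat N else 0)"
    by (intro prod.cong refl sum_root_pt assms)
  also have "\<dots> = (if \<alpha> = \<beta> then of_nat (N ^ n) else 0)"
  proof (cases "\<alpha> = \<beta>")
    case False
    then obtain k where k: "\<alpha> k \<noteq> \<beta> k" by auto
    with assms(1,2) have "k < n" by (auto simp: multi_indices_def) (metis not_le)
    with k False show ?thesis by (auto intro!: prod_zero)
  qed simp
  finally show ?thesis .
qed

lemma torus_coefficient: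
  assumes "finite A" "A \<subseteq> multi_indices n" "\<And>\<alpha> k. \<alpha> \<in> A \<Longrightarrow> \<alpha> k < N" "\<beta> \<in> A"
  shows "(\<Sum>j\<in>grid n N. (\<Sum>\<alpha>\<in>A. c \<alpha> * monomial n \<alpha> (torus_pt N j)) * cnj (monomial n \<beta> (torus_pt N j)))
       = of_nat (N ^ n) * c \<beta>"
proof -
  have "(\<Sum>j\<in>grid n N. (\<Sum>\<alpha>\<in>A. c \<alpha> * monomial n \<alpha> (torus_pt N j)) * cnj (monomial n \<beta> (torus_pt N j)))
     = (\<Sum>\<alpha>\<in>A. c \<alpha> * (\<Sum>j\<in>grid n N. monomial n \<alpha> (torus_pt N j) * cnj (monomial n \<beta> (torus_pt N j))))"
    by (simp add: sum_distrib_left sum_distrib_right mult.assoc) (rule sum.swap)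
  also have "\<dots> = (\<Sum>\<alpha>\<in>A. c \<alpha> * (if \<alpha> = \<beta> then of_nat (N ^ n) else 0))"
    by (intro sum.cong refl arg_cong2[where f="(*)"] torus_orthogonal) (use assms in auto)
  also have "\<dots> = of_nat (N ^ n) * c \<beta>"
    using assms by (simp add: if_distrib[of "\<lambda>x. c _ * x"] mult.commute cong: if_cong)
  finally show ?thesis .
qed

lemma torus_parseval:
  assumes "finite A" "A \<subseteq> multi_indices n" "\<And>\<alpha> k. \<alpha> \<in> A \<Longrightarrow> \<alpha> k < N"
  shows "(\<Sum>j\<in>grid n N. (cmod (\<Sum>\<alpha>\<in>A. c \<alpha> * monomial n \<alpha> (torus_pt N j)))\<^sup>2)
       = real (N ^ n) * (\<Sum>\<alpha>\<in>A. (cmod (c \<alpha>))\<^sup>2)"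
proof -
  let ?f = "\<lambda>j. \<Sum>\<alpha>\<in>A. c \<alpha> * monomial n \<alpha> (torus_pt N j)"
  have "of_real (\<Sum>j\<in>grid n N. (cmod (?f j))\<^sup>2) = (\<Sum>j\<in>grid n N. ?f j * cnj (?f j))"
    by (simp only: of_real_sum complex_norm_square)
  also have "\<dots> = (\<Sum>j\<in>grid n N. \<Sum>\<beta>\<in>A. cnj (c \<beta>) * (?f j * cnj (monomial n \<beta> (torus_pt N j))))"
    by (simp add: sum_distrib_left cnj_sum mult_ac)
  also have "\<dots> = (\<Sum>\<beta>\<in>A. cnj (c \<beta>) * (\<Sum>j\<in>grid n N. ?f j * cnj (monomial n \<beta> (torus_pt N j))))"
    by (subst sum.swap) (simp add: sum_distrib_left)
  also have "\<dots> = (\<Sum>\<beta>\<in>A. cnj (c \<beta>) * (of_nat (N ^ n) * c \<beta>))"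
    by (intro sum.cong refl arg_cong2[where f="(*)"] torus_coefficient) (use assms in auto)
  also have "\<dots> = of_real (real (N ^ n) * (\<Sum>\<alpha>\<in>A. (cmod (c \<alpha>))\<^sup>2))"
    unfolding of_real_mult of_real_sum complex_norm_square by (simp add: sum_distrib_left mult_ac)
  finally show ?thesis by (simp only: of_real_eq_iff)
qed

section \<open>Hypercontractivity on the torus\<close>

text \<open>A decomposition is determined by its first summand, which lies below
  \<open>\<gamma>\<close> entrywise. This leaves at most prod (\<open>\<gamma> k\<close> + 1)
  choices, and x + 1 <= 2^x.\<close>

lemma card_decompositions_le:
  assumes "\<gamma> \<in> hom_indices n (2 * q)"
  shows "card {p \<in> hom_indices n q \<times> hom_indices n q. (\<lambda>k. fst p k + snd p k) = \<gamma>} \<le> 4 ^ q"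
    (is "card ?P \<le> _")
proof -
  let ?r = "\<lambda>p::(nat \<Rightarrow> nat) \<times> (nat \<Rightarrow> nat). restrict (fst p) {..<n}"
  have inj: "inj_on ?r ?P"
  proof (rule inj_onI)
    fix p p' assume *: "p \<in> ?P" "p' \<in> ?P" "?r p = ?r p'"
    obtain \<alpha> \<beta> \<alpha>' \<beta>' where p: "p = (\<alpha>, \<beta>)" "p' = (\<alpha>', \<beta>')" by fastforce
    have "\<alpha> k = \<alpha>' k" for k
      using *(1,2) fun_cong[OF *(3), of k]
      by (cases "k < n") (simp_all add: p hom_indices_def multi_indices_def)
    moreover have "\<alpha> k + \<beta> k = \<alpha>' k + \<beta>' k" for k
      using *(1,2) by (auto simp: p fun_eq_iff)
    ultimately show "p = p'" by (auto simp: p fun_eq_iff)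
  qed
  have "card ?P = card (?r ` ?P)" by (rule card_image[OF inj, symmetric])
  also have "\<dots> \<le> card (PiE {..<n} (\<lambda>k. {..\<gamma> k}))"
    by (rule card_mono) (auto intro!: finite_PiE split: if_splits)
  also have "\<dots> = (\<Prod>k<n. \<gamma> k + 1)" by (simp add: card_PiE)
  also have "\<dots> \<le> (\<Prod>k<n. 2 ^ \<gamma> k)"
    by (intro prod_mono) (auto simp: Suc_le_eq)
  also have "\<dots> = 2 ^ (\<Sum>k<n. \<gamma> k)" by (simp add: power_sum)
  also have "\<dots> = 4 ^ q" using assms by (simp add: hom_indices_def power_mult)
  finally show ?thesis .
qed

lemma monomial_add: "monomial n (\<lambda>k. \<alpha> k + \<beta> k) z = monomial n \<alpha> z * monomial n \<beta> z"
  by (simp add: monomial_def power_add prod.distrib)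

lemma hom_indices_add:
  "\<alpha> \<in> hom_indices n q \<Longrightarrow> \<beta> \<in> hom_indices n q \<Longrightarrow> (\<lambda>k. \<alpha> k + \<beta> k) \<in> hom_indices n (2 * q)"
  by (simp add: hom_indices_def multi_indices_def sum.distrib)

text \<open>Expand \<open>Q\<^sup>2\<close>: a multi-index of degree \<open>2 q\<close> is a sum of two of degree \<open>q\<close> in at most \<open>4\<^sup>q\<close> ways.\<close>

lemma torus_L4_le:
  assumes "2 * q < N"
  shows "(\<Sum>j\<in>grid n N. cmod (hpoly n q d (torus_pt N j)) ^ 4)
       \<le> real (N ^ n) * 4 ^ q * (\<Sum>\<beta>\<in>hom_indices n q. (cmod (d \<beta>))\<^sup>2)\<^sup>2"
proof -
  let ?H = "hom_indices n q"
  let ?P = "\<lambda>\<gamma>. {p \<in> ?H \<times> ?H. (\<lambda>k. fst p k + snd p k) = \<gamma>}"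
  define e where "e \<gamma> = (\<Sum>p\<in>?P \<gamma>. d (fst p) * d (snd p))" for \<gamma>
  have fin: "finite (?H \<times> ?H)" by simp
  have im: "(\<lambda>p k. fst p k + snd p k) ` (?H \<times> ?H) \<subseteq> hom_indices n (2 * q)"
    by (auto intro: hom_indices_add)
  have square: "(hpoly n q d z)\<^sup>2 = (\<Sum>\<gamma>\<in>hom_indices n (2 * q). e \<gamma> * monomial n \<gamma> z)" for z
  proof -
    have "(hpoly n q d z)\<^sup>2 =
        (\<Sum>p\<in>?H \<times> ?H. d (fst p) * d (snd p) * monomial n (\<lambda>k. fst p k + snd p k) z)"
      by (simp add: hpoly_def power2_eq_square sum_product sum.cartesian_product monomial_add
          case_prod_beta mult_ac)
    also have "\<dots> = (\<Sum>\<gamma>\<in>hom_indices n (2 * q). \<Sum>p\<in>?P \<gamma>.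
        d (fst p) * d (snd p) * monomial n (\<lambda>k. fst p k + snd p k) z)"
      by (rule sum.group[symmetric]) (use fin im in auto)
    also have "\<dots> = (\<Sum>\<gamma>\<in>hom_indices n (2 * q). e \<gamma> * monomial n \<gamma> z)"
      unfolding e_def sum_distrib_right by (intro sum.cong refl) auto
    finally show ?thesis .
  qed
  have "(\<Sum>j\<in>grid n N. cmod (hpoly n q d (torus_pt N j)) ^ 4)
      = (\<Sum>j\<in>grid n N. (cmod ((hpoly n q d (torus_pt N j))\<^sup>2))\<^sup>2)"
    by (simp add: norm_power flip: power_mult)
  \<comment> \<open>Parseval for the square, whose exponents reach up to \<open>2 * q\<close>; hence
    the condition on \<open>N\<close>.\<close>
  also have "\<dots> = real (N ^ n) * (\<Sum>\<gamma>\<in>hom_indices n (2 * q). (cmod (e \<gamma>))\<^sup>2)"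
    unfolding square using assms hom_indices_le[of _ n "2 * q"] hom_indices_subset
    by (intro torus_parseval finite_hom_indices) (auto intro: le_less_trans)
  also have "\<dots> \<le> real (N ^ n) * (\<Sum>\<gamma>\<in>hom_indices n (2 * q).
      4 ^ q * (\<Sum>p\<in>?P \<gamma>. (cmod (d (fst p)))\<^sup>2 * (cmod (d (snd p)))\<^sup>2))"
  proof (intro mult_left_mono sum_mono)
    fix \<gamma> assume \<gamma>: "\<gamma> \<in> hom_indices n (2 * q)"
    have "cmod (e \<gamma>) \<le> (\<Sum>p\<in>?P \<gamma>. 1 * (cmod (d (fst p)) * cmod (d (snd p))))"
      unfolding e_def by (rule sum_norm_le) (simp add: norm_mult)
    then have "(cmod (e \<gamma>))\<^sup>2 \<le> (\<Sum>p\<in>?P \<gamma>. 1 * (cmod (d (fst p)) * cmod (d (snd p))))\<^sup>2"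
      by (intro power_mono) auto
    also have "\<dots> \<le> (\<Sum>p\<in>?P \<gamma>. 1\<^sup>2) * (\<Sum>p\<in>?P \<gamma>. (cmod (d (fst p)) * cmod (d (snd p)))\<^sup>2)"
      by (rule Cauchy_Schwarz_ineq_sum)
    also have "\<dots> \<le> 4 ^ q * (\<Sum>p\<in>?P \<gamma>. (cmod (d (fst p)) * cmod (d (snd p)))\<^sup>2)"
    proof (rule mult_right_mono)
      have "real (card (?P \<gamma>)) \<le> real (4 ^ q)"
        using card_decompositions_le[OF \<gamma>] by (simp only: of_nat_le_iff)
      then show "(\<Sum>p\<in>?P \<gamma>. 1\<^sup>2) \<le> (4::real) ^ q" by simp
    qed (auto intro: sum_nonneg)
    finally show "(cmod (e \<gamma>))\<^sup>2 \<le> 4 ^ q * (\<Sum>p\<in>?P \<gamma>. (cmod (d (fst p)))\<^sup>2 * (cmod (d (snd p)))\<^sup>2)"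
      by (simp add: power_mult_distrib)
  qed simp
  also have "\<dots> = real (N ^ n) * (4 ^ q * (\<Sum>p\<in>?H \<times> ?H. (cmod (d (fst p)))\<^sup>2 * (cmod (d (snd p)))\<^sup>2))"
    unfolding sum_distrib_left[symmetric] using fin im by (subst sum.group) auto
  also have "\<dots> = real (N ^ n) * 4 ^ q * (\<Sum>\<beta>\<in>?H. (cmod (d \<beta>))\<^sup>2)\<^sup>2"
    by (simp add: power2_eq_square sum_product sum.cartesian_product case_prod_beta)
  finally show ?thesis .
qed

text \<open>Interpolate \<open>L\<^sup>2\<close> between \<open>L\<^sup>1\<close> and \<open>L\<^sup>4\<close> by applying Cauchy-Schwarz twice.\<close>

lemma torus_L2_le_L1:
  assumes "2 * q < N"
  shows "real (N ^ n) * sqrt (\<Sum>\<beta>\<in>hom_indices n q. (cmod (d \<beta>))\<^sup>2)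
       \<le> 2 ^ q * (\<Sum>j\<in>grid n N. cmod (hpoly n q d (torus_pt N j)))"
proof -
  let ?x = "\<lambda>j. cmod (hpoly n q d (torus_pt N j))"
  let ?G = "grid n N"
  define s where "s = (\<Sum>\<beta>\<in>hom_indices n q. (cmod (d \<beta>))\<^sup>2)"
  define M where "M = real (N ^ n)"
  have M: "M > 0" using assms by (simp add: M_def)
  have s0: "s \<ge> 0" by (simp add: s_def sum_nonneg)
  have A2: "(\<Sum>j\<in>?G. (?x j)\<^sup>2) = M * s"
    unfolding M_def s_def hpoly_def using assms hom_indices_le[of _ n q] hom_indices_subset
    by (intro torus_parseval finite_hom_indices) (auto intro: le_less_trans[of _ q])
  have A4: "(\<Sum>j\<in>?G. ?x j ^ 4) \<le> M * 4 ^ q * s\<^sup>2"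
    unfolding M_def s_def by (rule torus_L4_le[OF assms])
  \<comment> \<open>Split x^2 as x^(1/2) * x^(3/2); below, x^3 is split as x * x^2.\<close>
  have cs1: "(\<Sum>j\<in>?G. (?x j)\<^sup>2)\<^sup>2 \<le> (\<Sum>j\<in>?G. ?x j) * (\<Sum>j\<in>?G. ?x j ^ 3)"
    using Cauchy_Schwarz_ineq_sum[of "\<lambda>j. sqrt (?x j)" "\<lambda>j. ?x j * sqrt (?x j)" ?G]
    by (simp add: power_mult_distrib power2_eq_square power3_eq_cube mult_ac)
  have cs2: "(\<Sum>j\<in>?G. ?x j ^ 3)\<^sup>2 \<le> (\<Sum>j\<in>?G. (?x j)\<^sup>2) * (\<Sum>j\<in>?G. ?x j ^ 4)"
    using Cauchy_Schwarz_ineq_sum[of ?x "\<lambda>j. (?x j)\<^sup>2" ?G]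
    by (simp add: eval_nat_numeral mult_ac)
  define A where "A = (\<Sum>j\<in>?G. ?x j)"
  define B where "B = (\<Sum>j\<in>?G. ?x j ^ 3)"
  have A0: "A \<ge> 0" and B0: "B \<ge> 0" by (auto simp: A_def B_def intro: sum_nonneg)
  have 1: "(M * s)\<^sup>2 \<le> A * B" using cs1 by (simp add: A2 A_def B_def)
  have 2: "B\<^sup>2 \<le> (M * s) * (M * 4 ^ q * s\<^sup>2)"
    using order_trans[OF cs2[unfolded A2] mult_left_mono[OF A4, of "M * s"]] M s0
    by (simp add: B_def)
  have "((M * s)\<^sup>2)\<^sup>2 \<le> (A * B)\<^sup>2" using 1 by (intro power_mono) auto
  also have "\<dots> \<le> A\<^sup>2 * ((M * s) * (M * 4 ^ q * s\<^sup>2))"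
    using mult_left_mono[OF 2, of "A\<^sup>2"] by (simp add: power_mult_distrib)
  finally have 3: "((M * s)\<^sup>2)\<^sup>2 \<le> A\<^sup>2 * ((M * s) * (M * 4 ^ q * s\<^sup>2))" .
  \<comment> \<open>The preceding inequality divided by M^2 s^3.\<close>
  have "M\<^sup>2 * s \<le> A\<^sup>2 * 4 ^ q"
  proof (cases "s = 0")
    case False
    then have pos: "M\<^sup>2 * s ^ 3 > 0" using s0 M by simp
    have "(M\<^sup>2 * s ^ 3) * (M\<^sup>2 * s) \<le> (M\<^sup>2 * s ^ 3) * (A\<^sup>2 * 4 ^ q)"
      using 3 by (simp add: eval_nat_numeral mult_ac)
    then show ?thesis using pos by (simp only: mult_le_cancel_left_pos)
  qed simp
  also have "A\<^sup>2 * 4 ^ q = (2 ^ q * A)\<^sup>2"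
    by (simp add: power_mult_distrib flip: power_mult) (simp add: mult.commute[of q] power_mult)
  finally have "sqrt (M\<^sup>2 * s) \<le> 2 ^ q * A" using A0 by (intro real_le_lsqrt) auto
  then show ?thesis using M by (simp add: real_sqrt_mult M_def s_def A_def)
qed

section \<open>Coefficient sums of bounded homogeneous polynomials\<close>

lemma hpoly_directional_derivative:
  "((\<lambda>t. hpoly n (Suc q) c (\<lambda>k. z k + t * w k)) has_field_derivative
     (\<Sum>k<n. w k * hpoly n q (deriv_coeff k c) z)) (at 0)"
proof -
  let ?h = "\<lambda>k \<alpha>. c \<alpha> * (w k * z k ^ (\<alpha> k - 1) * (\<Prod>i\<in>{..<n} - {k}. z i ^ \<alpha> i))"
  \<comment> \<open>The product rule. The truncated exponent \<open>\<alpha> k - 1\<close> does no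
    harm, as the factor \<open>\<alpha> k\<close> vanishes when
    \<open>\<alpha> k = 0\<close>.\<close>
  have mon: "((\<lambda>t. monomial n \<alpha> (\<lambda>k. z k + t * w k)) has_field_derivative
      (\<Sum>k<n. of_nat (\<alpha> k) * w k * z k ^ (\<alpha> k - 1) * (\<Prod>i\<in>{..<n} - {k}. z i ^ \<alpha> i))) (at 0)" for \<alpha>
  proof -
    have "((\<lambda>t. (z k + t * w k) ^ \<alpha> k) has_field_derivative
        of_nat (\<alpha> k) * w k * z k ^ (\<alpha> k - 1)) (at 0)" for k
      by (auto intro!: derivative_eq_intros)
    from has_field_derivative_prod[of "{..<n}", OF this] show ?thesis
      by (simp add: monomial_def)
  qed
  have eq: "(\<Sum>\<alpha>\<in>hom_indices n (Suc q). of_nat (\<alpha> k) * ?h k \<alpha>) = w k * hpoly n q (deriv_coeff k c) z"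
    if "k < n" for k
  proof -
    have "monomial n \<beta> z = z k ^ \<beta> k * (\<Prod>i\<in>{..<n} - {k}. z i ^ \<beta> i)" for \<beta>
      using that unfolding monomial_def by (subst prod.remove[of _ k]) auto
    moreover have "(\<Prod>i\<in>{..<n} - {k}. z i ^ (\<beta>(k := x)) i) = (\<Prod>i\<in>{..<n} - {k}. z i ^ \<beta> i)" for \<beta> x
      by (intro prod.cong) auto
    ultimately show ?thesis
      unfolding hom_indices_reindex[OF that]
      by (simp add: hpoly_def deriv_coeff_def sum_distrib_left mult_ac)
  qed
  have "((\<lambda>t. hpoly n (Suc q) c (\<lambda>k. z k + t * w k)) has_field_derivative
     (\<Sum>\<alpha>\<in>hom_indices n (Suc q). c \<alpha> * (\<Sum>k<n. of_nat (\<alpha> k) * w k * z k ^ (\<alpha> k - 1) *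
        (\<Prod>i\<in>{..<n} - {k}. z i ^ \<alpha> i)))) (at 0)"
    unfolding hpoly_def by (intro DERIV_sum DERIV_cmult mon)
  also have "(\<Sum>\<alpha>\<in>hom_indices n (Suc q). c \<alpha> * (\<Sum>k<n. of_nat (\<alpha> k) * w k * z k ^ (\<alpha> k - 1) *
        (\<Prod>i\<in>{..<n} - {k}. z i ^ \<alpha> i)))
     = (\<Sum>k<n. \<Sum>\<alpha>\<in>hom_indices n (Suc q). of_nat (\<alpha> k) * ?h k \<alpha>)"
    by (subst sum.swap) (simp add: sum_distrib_left mult_ac)
  also have "\<dots> = (\<Sum>k<n. w k * hpoly n q (deriv_coeff k c) z)"
    by (intro sum.cong refl eq) auto
  finally show ?thesis .
qed

text \<open>By \<open>conv\<close>, z + t w lies in \<open>V\<close> after division by 1 + |t|,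
  which homogeneity of degree m = q + 1 turns into a factor (1 + |t|)^m. On the circle of radius 1/m
  this is at most e, and Cauchy's inequality contributes the factor m.\<close>

lemma directional_derivative_bound:
  assumes bound: "\<And>v. v \<in> V \<Longrightarrow> cmod (hpoly n (Suc q) c v) \<le> S"
    and conv: "\<And>z w t. z \<in> V \<Longrightarrow> w \<in> V \<Longrightarrow> (\<lambda>k. (z k + t * w k) / of_real (1 + cmod t)) \<in> V"
    and "z \<in> V" "w \<in> V"
  shows "cmod (\<Sum>k<n. w k * hpoly n q (deriv_coeff k c) z) \<le> exp 1 * real (Suc q) * S"
proof -
  define m where "m = Suc q"
  define g where "g t = hpoly n m c (\<lambda>k. z k + t * w k)" for t
  have S: "S \<ge> 0" using bound[OF \<open>z \<in> V\<close>] norm_ge_zero order_trans by blast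
  have hol: "g holomorphic_on A" for A
    unfolding g_def hpoly_def monomial_def by (intro holomorphic_intros)
  have nof: "cmod (g t) \<le> (1 + 1 / real m) ^ m * S" if "cmod t = 1 / real m" for t
  proof -
    have nz: "complex_of_real (1 + cmod t) \<noteq> 0"
      by (metis add_pos_nonneg norm_ge_zero of_real_eq_0_iff order_less_irrefl zero_less_one)
    have "g t = hpoly n m c (\<lambda>k. of_real (1 + cmod t) * ((z k + t * w k) / of_real (1 + cmod t)))"
      unfolding g_def using nz by simp
    also have "\<dots> = of_real (1 + cmod t) ^ m * hpoly n m c (\<lambda>k. (z k + t * w k) / of_real (1 + cmod t))"
      by (rule hpoly_scale)
    finally have "cmod (g t) = (1 + cmod t) ^ m * cmod (hpoly n m c (\<lambda>k. (z k + t * w k) / of_real (1 + cmod t)))"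
      by (simp only: norm_mult norm_power norm_of_real) simp
    also have "\<dots> \<le> (1 + cmod t) ^ m * S"
      unfolding m_def by (intro mult_left_mono bound conv assms) auto
    finally show ?thesis using that by simp
  qed
  have "cmod ((deriv ^^ 1) g 0) \<le> fact 1 * ((1 + 1 / real m) ^ m * S) / (1 / real m) ^ 1"
    by (rule Cauchy_inequality[OF hol holomorphic_on_imp_continuous_on[OF hol]])
       (simp_all add: m_def nof[unfolded m_def] del: power_Suc of_nat_Suc)
  also have "\<dots> = real m * ((1 + 1 / real m) ^ m * S)" by simp
  also have "\<dots> \<le> real m * (exp 1 * S)"
  proof (intro mult_left_mono mult_right_mono S)
    have "(1 + 1 / real m) ^ m \<le> exp (1 / real m) ^ m"
      by (intro power_mono) auto
    also have "\<dots> = exp 1" unfolding exp_of_nat_mult[symmetric] by (simp add: m_def del: of_nat_Suc)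
    finally show "(1 + 1 / real m) ^ m \<le> exp 1" .
  qed auto
  also have "deriv g 0 = (\<Sum>k<n. w k * hpoly n q (deriv_coeff k c) z)"
    unfolding g_def m_def by (rule DERIV_imp_deriv[OF hpoly_directional_derivative])
  then have "(deriv ^^ 1) g 0 = (\<Sum>k<n. w k * hpoly n q (deriv_coeff k c) z)" by simp
  finally show ?thesis by (simp add: m_def mult_ac)
qed

text \<open>Euler's identity on the level of coefficients: the degree \<open>Suc q\<close> is the
  sum of the entries of \<open>\<alpha>\<close>.\<close>

lemma sum_hom_indices_Suc:
  fixes g :: "(nat \<Rightarrow> nat) \<Rightarrow> real"
  shows "real (Suc q) * (\<Sum>\<alpha>\<in>hom_indices n (Suc q). g \<alpha>) =
    (\<Sum>k<n. \<Sum>\<beta>\<in>hom_indices n q. real (Suc (\<beta> k)) * g (\<beta>(k := Suc (\<beta> k))))"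
proof -
  have "real (Suc q) * (\<Sum>\<alpha>\<in>hom_indices n (Suc q). g \<alpha>)
      = (\<Sum>\<alpha>\<in>hom_indices n (Suc q). \<Sum>k<n. real (\<alpha> k) * g \<alpha>)"
    unfolding sum_distrib_left sum_distrib_right[symmetric]
    by (intro sum.cong refl) (simp add: hom_indices_def flip: of_nat_sum)
  also have "\<dots> = (\<Sum>k<n. \<Sum>\<alpha>\<in>hom_indices n (Suc q). real (\<alpha> k) * g \<alpha>)"
    by (rule sum.swap)
  finally show ?thesis by (simp add: hom_indices_reindex)
qed

section \<open>The polydisc: coefficient sums from hypercontractivity\<close>

lemma two_le_exp1: "(2::real) \<le> exp 1"
  using exp_ge_add_one_self[of 1] by simp

text \<open>Cauchy's inequality bounds the sum over \<open>k\<close> of all |D_k| at once, so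
  passing from L1 to L2 for each \<open>k\<close> separately loses only \<open>2 ^ q\<close> and no
  power of \<open>n\<close>.\<close>

lemma polydisc_coefficient_sum:
  assumes bound: "\<And>v. (\<And>k. k < n \<Longrightarrow> cmod (v k) \<le> 1) \<Longrightarrow> cmod (hpoly n (Suc q) c v) \<le> S"
  shows "(\<Sum>\<alpha>\<in>hom_indices n (Suc q). cmod (c \<alpha>)) \<le> exp (real (Suc q)) * sqrt (card (hom_indices n q)) * S"
proof -
  define V where "V = {v::nat \<Rightarrow> complex. \<forall>k<n. cmod (v k) \<le> 1}"
  define N where "N = Suc (2 * q)"
  define D where "D k = hpoly n q (deriv_coeff k c)" for k
  define A where "A k = sqrt (\<Sum>\<beta>\<in>hom_indices n q. (cmod (deriv_coeff k c \<beta>))\<^sup>2)" for k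
  have S: "S \<ge> 0" using bound[of "\<lambda>_. 0"] norm_ge_zero order_trans by (metis norm_zero zero_le_one)
  have conv: "(\<lambda>k. (z k + t * w k) / of_real (1 + cmod t)) \<in> V" if "z \<in> V" "w \<in> V" for z w t
    unfolding V_def
  proof (intro CollectI allI impI)
    fix k assume "k < n"
    then have "cmod (z k) \<le> 1" "cmod (w k) \<le> 1" using that by (auto simp: V_def)
    then have "cmod (z k + t * w k) \<le> 1 + cmod t"
      using norm_triangle_ineq[of "z k" "t * w k"] mult_left_mono[of "cmod (w k)" 1 "cmod t"]
      by (simp add: norm_mult)
    moreover have "0 < 1 + cmod t" by (simp add: add_pos_nonneg)
    ultimately show "cmod ((z k + t * w k) / of_real (1 + cmod t)) \<le> 1"
      by (simp only: norm_divide norm_of_real) simp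
  qed
  have pointwise: "(\<Sum>k<n. cmod (D k z)) \<le> exp 1 * real (Suc q) * S" if "z \<in> V" for z
  proof -
    \<comment> \<open>These weights turn the directional derivative at \<open>z\<close> into a sum
      of moduli.\<close>
    define w where "w k = cnj (sgn (D k z))" for k
    have "w k * D k z = of_real (cmod (D k z))" for k
      by (simp add: w_def cnj_sgn_mult)
    then have "cmod (\<Sum>k<n. w k * D k z) = cmod (of_real (\<Sum>k<n. cmod (D k z)))" by simp
    then have "cmod (\<Sum>k<n. w k * D k z) = (\<Sum>k<n. cmod (D k z))"
      unfolding norm_of_real by (simp add: sum_nonneg)
    moreover have "w \<in> V" by (simp add: V_def w_def norm_sgn)
    then have "cmod (\<Sum>k<n. w k * D k z) \<le> exp 1 * real (Suc q) * S"
      unfolding D_def using that by (intro directional_derivative_bound[of V] bound conv) (auto simp: V_def)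
    ultimately show ?thesis by simp
  qed
  have "real (N ^ n) * (\<Sum>k<n. A k) \<le> (\<Sum>k<n. 2 ^ q * (\<Sum>j\<in>grid n N. cmod (D k (torus_pt N j))))"
    unfolding sum_distrib_left A_def D_def
    by (rule sum_mono) (use torus_L2_le_L1[of q N] in \<open>simp add: N_def sum_distrib_left\<close>)
  also have "\<dots> = 2 ^ q * (\<Sum>j\<in>grid n N. \<Sum>k<n. cmod (D k (torus_pt N j)))"
    by (subst sum.swap) (simp add: sum_distrib_left)
  also have "\<dots> \<le> 2 ^ q * (\<Sum>j\<in>grid n N. exp 1 * real (Suc q) * S)"
    by (intro mult_left_mono sum_mono pointwise) (auto simp: V_def)
  also have "\<dots> = real (N ^ n) * (2 ^ q * (exp 1 * real (Suc q) * S))"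
    by (simp add: card_grid mult_ac)
  finally have sumA: "(\<Sum>k<n. A k) \<le> 2 ^ q * (exp 1 * real (Suc q) * S)"
    by (simp add: N_def)
  have cs: "(\<Sum>\<beta>\<in>hom_indices n q. cmod (deriv_coeff k c \<beta>)) \<le> sqrt (card (hom_indices n q)) * A k" for k
    using Cauchy_Schwarz_ineq_sum[of "\<lambda>_. 1" "\<lambda>\<beta>. cmod (deriv_coeff k c \<beta>)" "hom_indices n q"]
    unfolding A_def real_sqrt_mult[symmetric] by (intro real_le_rsqrt) simp
  have "real (Suc q) * (\<Sum>\<alpha>\<in>hom_indices n (Suc q). cmod (c \<alpha>))
      = (\<Sum>k<n. \<Sum>\<beta>\<in>hom_indices n q. cmod (deriv_coeff k c \<beta>))"
    unfolding sum_hom_indices_Suc deriv_coeff_def norm_mult norm_of_nat by simp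
  also have "\<dots> \<le> sqrt (card (hom_indices n q)) * (\<Sum>k<n. A k)"
    unfolding sum_distrib_left by (intro sum_mono cs)
  also have "\<dots> \<le> sqrt (card (hom_indices n q)) * (2 ^ q * (exp 1 * real (Suc q) * S))"
    by (intro mult_left_mono sumA) auto
  \<comment> \<open>Weakening 2 to e merges the constants; the factor \<open>Suc q\<close> from
    Cauchy's inequality then cancels the one from Euler's identity.\<close>
  also have "\<dots> \<le> sqrt (card (hom_indices n q)) * (exp 1 ^ q * (exp 1 * real (Suc q) * S))"
    using S by (intro mult_left_mono mult_right_mono power_mono two_le_exp1) auto
  also have "\<dots> = real (Suc q) * (exp (real (Suc q)) * sqrt (card (hom_indices n q)) * S)"
    by (simp add: exp_add mult_ac flip: exp_of_nat_mult)
  finally show ?thesis by (simp only: mult_le_cancel_left_pos of_nat_0_less_iff zero_less_Suc)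
qed

section \<open>The p-norm: coefficient sums from optimal points of the sphere\<close>

lemma powr_convex_nonneg:
  fixes p :: real
  assumes "1 \<le> p"
  shows "convex_on {0..} (\<lambda>x. x powr p)"
proof (rule convex_onI)
  fix t x y :: real
  assume t: "0 < t" "t < 1" and xy: "x \<in> {0..}" "y \<in> {0..}"
  have shrink: "(a * b) powr p \<le> a * b powr p" if "0 < a" "a < 1" "0 \<le> b" for a b :: real
    using that assms powr_mono'[of 1 p a] by (auto simp: powr_mult intro!: mult_right_mono)
  \<comment> \<open>If an argument is 0, t^p <= t on (0,1) suffices; otherwise convexity on the
    positive reals applies.\<close>
  consider "x = 0" | "y = 0" | "x > 0" "y > 0" using xy by fastforce
  then show "((1 - t) *\<^sub>R x + t *\<^sub>R y) powr p \<le> (1 - t) * x powr p + t * y powr p"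
  proof cases
    case 3
    then show ?thesis
      using convex_onD[OF powr_convex[OF assms], of t x y] t by simp
  qed (use shrink[of t y] shrink[of "1 - t" x] t xy in auto)
qed (simp add: convex_real_interval)

text \<open>Jensen's inequality for the p-th power with equal weights
  \<open>1 / card J\<close>.\<close>

lemma sum_le_power_mean:
  fixes x :: "'a \<Rightarrow> real"
  assumes "1 \<le> p" "finite J" and x: "\<And>j. j \<in> J \<Longrightarrow> 0 \<le> x j"
  shows "(\<Sum>j\<in>J. x j) \<le> card J powr (1 - 1 / p) * (\<Sum>j\<in>J. x j powr p) powr (1 / p)"
proof (cases "J = {}")
  case False
  define m where "m = real (card J)"
  have m: "m > 0" using assms False by (simp add: m_def card_gt_0_iff)
  have "(\<Sum>j\<in>J. (1 / m) *\<^sub>R x j) powr p \<le> (\<Sum>j\<in>J. (1 / m) * x j powr p)"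
    by (rule convex_on_sum[OF \<open>finite J\<close> False powr_convex_nonneg[OF \<open>1 \<le> p\<close>]])
       (use m x in \<open>auto simp: m_def\<close>)
  then have 1: "((\<Sum>j\<in>J. x j) / m) powr p \<le> (\<Sum>j\<in>J. x j powr p) / m"
    by (simp add: sum_divide_distrib)
  have "(\<Sum>j\<in>J. x j) / m = (((\<Sum>j\<in>J. x j) / m) powr p) powr (1 / p)"
    using assms m by (simp add: powr_powr sum_nonneg)
  also have "\<dots> \<le> ((\<Sum>j\<in>J. x j powr p) / m) powr (1 / p)"
    by (rule powr_mono2) (use assms 1 in auto)
  finally have "(\<Sum>j\<in>J. x j) \<le> m * ((\<Sum>j\<in>J. x j powr p) / m) powr (1 / p)"
    using m by (simp add: divide_le_eq mult.commute)
  also have "\<dots> = m powr (1 - 1 / p) * (\<Sum>j\<in>J. x j powr p) powr (1 / p)"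
    using m by (simp add: powr_divide sum_nonneg powr_diff)
  finally show ?thesis by (simp add: m_def)
qed simp

text \<open>Cauchy's coefficient estimate on the torus through \<open>z\<close>. Exponents are at
  most \<open>q\<close>, so an average over \<open>q + 1\<close> roots of unity in each variable
  replaces the integral.\<close>

lemma torus_cauchy_estimate:
  assumes bound: "\<And>\<zeta>. (\<And>k. cmod (\<zeta> k) = 1) \<Longrightarrow> cmod (hpoly n q d (\<lambda>k. z k * \<zeta> k)) \<le> T"
    and \<beta>: "\<beta> \<in> hom_indices n q"
  shows "cmod (d \<beta>) * cmod (monomial n \<beta> z) \<le> T"
proof -
  define N where "N = Suc q"
  have "(\<Sum>j\<in>grid n N. hpoly n q d (\<lambda>k. z k * torus_pt N j k) * cnj (monomial n \<beta> (torus_pt N j)))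
      = of_nat (N ^ n) * (d \<beta> * monomial n \<beta> z)"
    unfolding hpoly_def monomial_mult mult.assoc[symmetric, of "d _"]
    by (rule torus_coefficient)
       (use hom_indices_subset hom_indices_le[of _ n q] \<beta> in \<open>auto simp: N_def less_Suc_eq_le\<close>)
  then have "real (N ^ n) * (cmod (d \<beta>) * cmod (monomial n \<beta> z)) =
      cmod (\<Sum>j\<in>grid n N. hpoly n q d (\<lambda>k. z k * torus_pt N j k) * cnj (monomial n \<beta> (torus_pt N j)))"
    by (simp only: norm_mult norm_of_nat)
  also have "\<dots> \<le> (\<Sum>j\<in>grid n N. T)"
    by (rule sum_norm_le) (use bound in \<open>simp add: norm_mult cmod_monomial\<close>)
  also have "\<dots> = real (N ^ n) * T" by (simp add: card_grid)
  finally show ?thesis by (simp add: N_def)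
qed

lemma sum_exp_series_le:
  fixes x :: real
  assumes "0 \<le> x"
  shows "(\<Sum>i\<le>q. x ^ i / fact i) \<le> exp x"
proof -
  have "(\<Sum>i\<le>q. x ^ i /\<^sub>R fact i) \<le> (\<Sum>i. x ^ i /\<^sub>R fact i)"
    by (rule sum_le_suminf[OF summable_exp_generic]) (use assms in auto)
  then show ?thesis by (simp add: exp_def divide_inverse mult.commute)
qed

text \<open>For each \<open>\<beta>\<close>, a direction adapted to it makes the coefficient of the
  derivative at \<open>\<beta>\<close> equal to the sum of |u_k| |d_k|, and evaluation near
  \<open>z \<beta>\<close> bounds that by T / \<open>y \<beta>\<close>. What remains is the sum of
  the ratios \<open>x \<beta>\<close>, whose p-th powers are dominated by the expansion of exp (q
  sum |u_k|^p).\<close>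

lemma lp_coefficient_sum:
  fixes p :: real
  assumes p: "1 \<le> p"
    and bound: "\<And>v. (\<Sum>k<n. cmod (v k) powr p) \<le> 1 \<Longrightarrow> cmod (hpoly n (Suc q) c v) \<le> S"
    and u: "(\<Sum>k<n. cmod (u k) powr p) \<le> 1"
  shows "(\<Sum>\<alpha>\<in>hom_indices n (Suc q). cmod (c \<alpha> * monomial n \<alpha> u))
       \<le> exp (real (Suc q)) * card (hom_indices n q) powr (1 - 1 / p) * S"
proof -
  let ?H = "hom_indices n q"
  define V where "V = {v::nat \<Rightarrow> complex. (\<Sum>k<n. cmod (v k) powr p) \<le> 1}"
  define d where "d k = deriv_coeff k c" for k
  \<comment> \<open>\<open>z \<beta>\<close> maximises \<open>|z\<^sup>\<beta>|\<close> on the unit sphere of the p-norm (for \<open>q = 0\<close> it is 0 and \<open>\<beta> = 0\<close>).\<close>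
  define z where "z \<beta> k = complex_of_real ((real (\<beta> k) / real q) powr (1 / p))" for \<beta> :: "nat \<Rightarrow> nat" and k
  define y where "y \<beta> = cmod (monomial n \<beta> (z \<beta>))" for \<beta>
  define x where "x \<beta> = cmod (monomial n \<beta> u) / y \<beta>" for \<beta>
  define T where "T = exp 1 * real (Suc q) * S"
  have S: "S \<ge> 0" using bound[of "\<lambda>_. 0"] norm_ge_zero order_trans by (simp, blast)
  then have T: "T \<ge> 0" by (simp add: T_def)
  have conv: "(\<lambda>k. (z k + t * w k) / of_real (1 + cmod t)) \<in> V" if "z \<in> V" "w \<in> V" for z w t
  proof -
    let ?r = "1 + cmod t"
    have r: "?r > 0" by (simp add: add_pos_nonneg)
    have "cmod ((z k + t * w k) / of_real ?r) powr p
        \<le> (1 / ?r) * cmod (z k) powr p + (cmod t / ?r) * cmod (w k) powr p" for k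
    proof -
      have "cmod ((z k + t * w k) / of_real ?r) = cmod (z k + t * w k) / ?r"
        using r by (simp only: norm_divide norm_of_real)
      also have "\<dots> \<le> (cmod (z k) + cmod t * cmod (w k)) / ?r"
        using r norm_triangle_ineq[of "z k" "t * w k"]
        by (intro divide_right_mono) (auto simp: norm_mult)
      also have "\<dots> = (1 / ?r) * cmod (z k) + (cmod t / ?r) * cmod (w k)"
        by (simp add: add_divide_distrib)
      finally have "cmod ((z k + t * w k) / of_real ?r) powr p
          \<le> ((1 / ?r) * cmod (z k) + (cmod t / ?r) * cmod (w k)) powr p"
        using p by (intro powr_mono2) auto
      also have "\<dots> = ((1 - cmod t / ?r) * cmod (z k) + (cmod t / ?r) * cmod (w k)) powr p"
        using r by (simp add: field_simps)
      also have "\<dots> \<le> (1 - cmod t / ?r) * cmod (z k) powr p + (cmod t / ?r) * cmod (w k) powr p"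
        using convex_onD[OF powr_convex_nonneg[OF p], of "cmod t / ?r" "cmod (z k)" "cmod (w k)"] r
        by simp
      also have "1 - cmod t / ?r = 1 / ?r" using r by (simp add: field_simps)
      finally show ?thesis .
    qed
    then have "(\<Sum>k<n. cmod ((z k + t * w k) / of_real ?r) powr p)
        \<le> (\<Sum>k<n. (1 / ?r) * cmod (z k) powr p + (cmod t / ?r) * cmod (w k) powr p)"
      by (intro sum_mono)
    also have "\<dots> = (1 / ?r) * (\<Sum>k<n. cmod (z k) powr p) + (cmod t / ?r) * (\<Sum>k<n. cmod (w k) powr p)"
      by (simp add: sum.distrib sum_distrib_left)
    also have "\<dots> \<le> (1 / ?r) * 1 + (cmod t / ?r) * 1"
      using that r by (intro add_mono mult_left_mono) (auto simp: V_def)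
    also have "\<dots> = 1" using r by (simp add: field_simps)
    finally show ?thesis by (simp only: V_def mem_Collect_eq)
  qed
  \<comment> \<open>Where \<open>\<beta> k = 0\<close> the coordinate of \<open>z \<beta>\<close> is
    0, but the factor is 0^0 = 1.\<close>
  have y0: "y \<beta> > 0" if "\<beta> \<in> ?H" for \<beta>
  proof -
    have "cmod (z \<beta> k) ^ \<beta> k > 0" for k
      using hom_indices_le[OF that, of k] by (cases "\<beta> k = 0") (auto simp: z_def)
    then show ?thesis unfolding y_def cmod_monomial by (intro prod_pos) auto
  qed
  have zV: "(\<lambda>k. z \<beta> k * \<zeta> k) \<in> V" if "\<beta> \<in> ?H" "\<And>k. cmod (\<zeta> k) = 1" for \<beta> \<zeta>
  proof -
    have "(\<Sum>k<n. cmod (z \<beta> k * \<zeta> k) powr p) = (\<Sum>k<n. real (\<beta> k)) / real q"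
      using p that by (simp add: norm_mult z_def powr_powr sum_divide_distrib)
    also have "\<dots> \<le> 1" using that by (simp add: hom_indices_def divide_le_eq flip: of_nat_sum)
    finally show ?thesis by (simp add: V_def)
  qed
  have inner: "(\<Sum>k<n. cmod (u k) * cmod (d k \<beta>)) * y \<beta> \<le> T" if \<beta>: "\<beta> \<in> ?H" for \<beta>
  proof -
    \<comment> \<open>The moduli keep \<open>w\<close> in \<open>V\<close>; the phases are aligned
      for this one \<open>\<beta>\<close>, while \<open>dd\<close> gives the coefficients of the
      derivative at all multi-indices.\<close>
    define w where "w k = complex_of_real (cmod (u k)) * cnj (sgn (d k \<beta>))" for k
    define dd where "dd \<beta> = (\<Sum>k<n. w k * d k \<beta>)" for \<beta>
    have "cmod (w k) \<le> cmod (u k)" for k by (simp add: w_def norm_mult norm_sgn)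
    then have "(\<Sum>k<n. cmod (w k) powr p) \<le> (\<Sum>k<n. cmod (u k) powr p)"
      using p by (intro sum_mono powr_mono2) auto
    then have wV: "w \<in> V" using u by (simp add: V_def)
    have dd: "dd \<beta> = of_real (\<Sum>k<n. cmod (u k) * cmod (d k \<beta>))"
      by (simp add: dd_def w_def mult.assoc cnj_sgn_mult)
    have hp: "hpoly n q dd v = (\<Sum>k<n. w k * hpoly n q (d k) v)" for v
      unfolding hpoly_def dd_def sum_distrib_left sum_distrib_right
      by (subst sum.swap) (simp add: mult.assoc)
    have "cmod (dd \<beta>) * cmod (monomial n \<beta> (z \<beta>)) \<le> T"
      by (rule torus_cauchy_estimate[OF _ \<beta>])
         (unfold hp d_def T_def, intro directional_derivative_bound[of V] bound conv zV[OF \<beta>] wV,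
          auto simp: V_def)
    moreover have "cmod (dd \<beta>) = (\<Sum>k<n. cmod (u k) * cmod (d k \<beta>))"
      unfolding dd norm_of_real by (simp add: sum_nonneg)
    ultimately show ?thesis by (simp add: y_def)
  qed
  \<comment> \<open>The p-th power of the k-th coordinate of \<open>z \<beta>\<close> is b/q with b
    = \<open>\<beta> k\<close>, so the k-th factor is (q |u_k|^p)^b / b^b, and b! <= b^b.\<close>
  have xp: "x \<beta> powr p \<le> (\<Prod>k<n. (real q * cmod (u k) powr p) ^ \<beta> k / fact (\<beta> k))" if \<beta>: "\<beta> \<in> ?H" for \<beta>
  proof -
    have "x \<beta> = (\<Prod>k<n. cmod (u k) ^ \<beta> k / cmod (z \<beta> k) ^ \<beta> k)"
      by (simp add: x_def y_def cmod_monomial prod_dividef)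
    then have "x \<beta> powr p = (\<Prod>k<n. (cmod (u k) ^ \<beta> k / cmod (z \<beta> k) ^ \<beta> k) powr p)"
      by (simp add: prod_powr_distrib)
    also have "\<dots> \<le> (\<Prod>k<n. (real q * cmod (u k) powr p) ^ \<beta> k / fact (\<beta> k))"
    proof (intro prod_mono conjI)
      fix k
      show "(cmod (u k) ^ \<beta> k / cmod (z \<beta> k) ^ \<beta> k) powr p \<le> (real q * cmod (u k) powr p) ^ \<beta> k / fact (\<beta> k)"
      proof (cases "\<beta> k = 0")
        case False
        define b where "b = \<beta> k"
        have b: "b > 0" "q > 0" using False hom_indices_le[OF \<beta>, of k] by (auto simp: b_def)
        have zp: "cmod (z \<beta> k) powr p = real b / real q"
          using p by (simp add: z_def powr_powr b_def)
        have "(a ^ b) powr p = (a powr p) ^ b" if "a \<ge> 0" for a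
          using that by (induction b) (auto simp: powr_mult)
        then have "(cmod (u k) ^ b / cmod (z \<beta> k) ^ b) powr p = ((cmod (u k) / cmod (z \<beta> k)) powr p) ^ b"
          by (simp add: power_divide powr_divide)
        also have "\<dots> = (real q * cmod (u k) powr p) ^ b / real b ^ b"
          using b by (simp add: powr_divide zp power_divide power_mult_distrib)
        also have "\<dots> \<le> (real q * cmod (u k) powr p) ^ b / fact b"
          by (intro divide_left_mono) (use b fact_le_power[of b, where 'a=real] in auto)
        finally show ?thesis by (simp add: b_def)
      qed simp
    qed auto
    finally show ?thesis .
  qed
  have "(\<Sum>\<beta>\<in>?H. x \<beta> powr p) \<le> (\<Sum>\<beta>\<in>?H. \<Prod>k<n. (real q * cmod (u k) powr p) ^ \<beta> k / fact (\<beta> k))"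
    by (intro sum_mono xp)
  also have "\<dots> \<le> (\<Prod>k<n. \<Sum>i\<le>q. (real q * cmod (u k) powr p) ^ i / fact i)"
    by (rule sum_hom_indices_prod_le) auto
  also have "\<dots> \<le> (\<Prod>k<n. exp (real q * cmod (u k) powr p))"
    by (intro prod_mono conjI sum_exp_series_le sum_nonneg) auto
  also have "\<dots> = exp (real q * (\<Sum>k<n. cmod (u k) powr p))"
    by (simp add: exp_sum sum_distrib_left)
  also have "\<dots> \<le> exp (real q * 1)" using u by (intro exp_le_cancel_iff[THEN iffD2] mult_left_mono) auto
  finally have "(\<Sum>\<beta>\<in>?H. x \<beta> powr p) powr (1 / p) \<le> exp (real q) powr (1 / p)"
    using p by (intro powr_mono2) (auto intro: sum_nonneg)
  also have "\<dots> \<le> exp (real q)"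
    using p by (simp add: exp_powr_real divide_le_eq)
       (metis mult_left_mono mult.right_neutral of_nat_0_le_iff)
  finally have xsum: "(\<Sum>\<beta>\<in>?H. x \<beta> powr p) powr (1 / p) \<le> exp (real q)" .
  have mon: "cmod (monomial n (\<beta>(k := Suc (\<beta> k))) u) = cmod (monomial n \<beta> u) * cmod (u k)" if "k < n" for \<beta> k
  proof -
    have "(\<Prod>i\<in>{..<n} - {k}. u i ^ (\<beta>(k := Suc (\<beta> k))) i) = (\<Prod>i\<in>{..<n} - {k}. u i ^ \<beta> i)"
      by (intro prod.cong) auto
    then show ?thesis
      using that unfolding monomial_def norm_mult[symmetric]
      by (subst (1 2) prod.remove[of _ k]) (auto simp: mult_ac)
  qed
  have "real (Suc q) * (\<Sum>\<alpha>\<in>hom_indices n (Suc q). cmod (c \<alpha> * monomial n \<alpha> u))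
      = (\<Sum>k<n. \<Sum>\<beta>\<in>?H. cmod (monomial n \<beta> u) * (cmod (u k) * cmod (d k \<beta>)))"
    unfolding sum_hom_indices_Suc d_def deriv_coeff_def
    by (intro sum.cong refl) (simp add: norm_mult mon mult_ac del: of_nat_Suc)
  \<comment> \<open>Write |u^\<beta>| as \<open>x \<beta> * y \<beta>\<close>, so that
    \<open>inner\<close> applies to each term.\<close>
  also have "\<dots> = (\<Sum>\<beta>\<in>?H. x \<beta> * ((\<Sum>k<n. cmod (u k) * cmod (d k \<beta>)) * y \<beta>))"
    using y0 unfolding x_def
    by (subst sum.swap, intro sum.cong refl) (simp add: sum_distrib_left order_less_imp_not_eq2)
  also have "\<dots> \<le> (\<Sum>\<beta>\<in>?H. x \<beta> * T)"
    by (intro sum_mono mult_left_mono inner) (auto simp: x_def y_def)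
  also have "\<dots> = (\<Sum>\<beta>\<in>?H. x \<beta>) * T" by (simp add: sum_distrib_right)
  also have "\<dots> \<le> (card ?H powr (1 - 1 / p) * (\<Sum>\<beta>\<in>?H. x \<beta> powr p) powr (1 / p)) * T"
    by (intro mult_right_mono sum_le_power_mean p T) (auto simp: x_def y_def)
  also have "\<dots> \<le> (card ?H powr (1 - 1 / p) * exp (real q)) * T"
    by (intro mult_right_mono mult_left_mono xsum T) auto
  also have "\<dots> = real (Suc q) * (exp (real (Suc q)) * card ?H powr (1 - 1 / p) * S)"
    by (simp add: T_def exp_add mult_ac)
  finally show ?thesis by (simp only: mult_le_cancel_left_pos of_nat_0_less_iff zero_less_Suc)
qed

section \<open>Counting monomials\<close>

text \<open>The left side is the degree q part of the n-th power of the geometric series.\<close>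

lemma card_hom_indices_le:
  assumes "0 \<le> x" "x < 1"
  shows "real (card (hom_indices n q)) * x ^ q \<le> (1 / (1 - x)) ^ n"
proof -
  have "real (card (hom_indices n q)) * x ^ q = (\<Sum>\<alpha>\<in>hom_indices n q. \<Prod>k<n. x ^ \<alpha> k)"
    by (simp add: hom_indices_def flip: power_sum)
  also have "\<dots> \<le> (\<Prod>k<n. \<Sum>i\<le>q. x ^ i)"
    by (rule sum_hom_indices_prod_le) (use assms in auto)
  also have "\<dots> = (\<Sum>i\<le>q. x ^ i) ^ n" by simp
  also have "\<dots> \<le> (1 / (1 - x)) ^ n"
  proof (rule power_mono)
    show "(\<Sum>i\<le>q. x ^ i) \<le> 1 / (1 - x)" using assms by (simp add: sum_gp0 divide_right_mono)
  qed (use assms in \<open>auto intro: sum_nonneg\<close>)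
  finally show ?thesis .
qed

text \<open>There is one more factor \<open>L\<close> than the degree \<open>q\<close> counted;
  without it, a factor sqrt n would remain in the bound obtained here.\<close>

lemma card_hom_indices_log:
  assumes "1 \<le> n"
  defines "L \<equiv> ln (real n) / real n"
  shows "L ^ Suc q * real (card (hom_indices n q)) \<le> 4 ^ Suc q"
proof -
  \<comment> \<open>With this choice \<open>(1 - x)\<^bsup>-n\<^esup> \<le> \<surd>n\<close>, which the one extra factor \<open>L\<close> absorbs.\<close>
  define x where "x = L / 4"
  have n: "real n > 0" using assms by simp
  have L: "0 \<le> L" "L \<le> 1"
    using assms ln_bound[of "real n"] by (auto simp: L_def)
  have x: "0 \<le> x" "x \<le> 1 / 4" using L by (auto simp: x_def)
  \<comment> \<open>The product is 1 + x - 2 x^2, and x <= 1/4.\<close>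
  have "1 \<le> (1 - x) * (1 + 2 * x)"
    using x mult_left_mono[of x "1/4" x] by (simp add: algebra_simps)
  also have "\<dots> \<le> (1 - x) * exp (2 * x)"
    using x exp_ge_add_one_self[of "2 * x"] by (intro mult_left_mono) auto
  finally have "1 / (1 - x) \<le> exp (2 * x)" using x by (simp add: divide_le_eq mult.commute)
  then have "(1 / (1 - x)) ^ n \<le> exp (2 * x) ^ n" using x by (intro power_mono) auto
  also have "\<dots> = exp (ln (real n) / 2)"
    using n by (simp add: x_def L_def flip: exp_of_nat_mult)
  also have "\<dots> = sqrt (real n)" using n by (simp add: powr_half_sqrt[symmetric] powr_def)
  finally have card: "real (card (hom_indices n q)) * x ^ q \<le> sqrt (real n)"
    using card_hom_indices_le[of x n q] x by linarith
  \<comment> \<open>Apply ln y <= y at y = sqrt n to get ln n <= 2 sqrt n.\<close>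
  have "ln (real n) = 2 * ln (sqrt (real n))" using n by (simp add: ln_sqrt)
  also have "\<dots> \<le> 2 * sqrt (real n)" using n ln_bound[of "sqrt (real n)"] by simp
  finally have "sqrt (real n) * L \<le> sqrt (real n) * (2 * sqrt (real n) / real n)"
    using n by (intro mult_left_mono) (auto simp: L_def divide_right_mono)
  also have "\<dots> = 2" using n by (simp add: field_simps)
  finally have two: "sqrt (real n) * L \<le> 2" .
  have "L ^ Suc q * real (card (hom_indices n q)) = 4 ^ q * ((real (card (hom_indices n q)) * x ^ q) * L)"
    by (simp add: x_def power_divide)
  also have "\<dots> \<le> 4 ^ q * (sqrt (real n) * L)"
    using card L by (intro mult_left_mono mult_right_mono) auto
  also have "\<dots> \<le> 4 ^ q * 4" using two by simp
  finally show ?thesis by simp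
qed

section \<open>From homogeneous polynomials to the Bohr inequality\<close>

text \<open>Rotate so that the constant term is |h 0|, then average over roots of unity against a
  nonnegative weight of mean 1: the average is at most \<open>B\<close> in modulus and equals |h 0|
  + |h m| / 2.\<close>

lemma polynomial_caratheodory:
  fixes h :: "nat \<Rightarrow> complex"
  assumes bound: "\<And>t. cmod t = 1 \<Longrightarrow> cmod (\<Sum>k\<le>K. h k * t ^ k) \<le> B"
    and m: "1 \<le> m" "m \<le> K"
  shows "cmod (h m) \<le> 2 * (B - cmod (h 0))"
proof -
  have unit: "\<exists>c. cmod c = 1 \<and> c * x = of_real (cmod x)" for x :: complex
  proof (cases "x = 0")
    case False
    then have "cmod (cnj (sgn x)) = 1 \<and> cnj (sgn x) * x = of_real (cmod x)"
      by (simp add: norm_sgn cnj_sgn_mult)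
    then show ?thesis by blast
  qed (auto intro: exI[of _ 1])
  obtain c where c: "cmod c = 1" "c * h 0 = of_real (cmod (h 0))" using unit by blast
  obtain \<mu> where \<mu>: "cmod \<mu> = 1" "\<mu> * (c * h m) = of_real (cmod (c * h m))" using unit by blast
  \<comment> \<open>All exponents that occur, up to \<open>K + m\<close>, stay below
    \<open>N\<close>.\<close>
  define N where "N = Suc (K + m)"
  define t where "t j = root_pt N j" for j
  define T where "T j = (\<Sum>k\<le>K. h k * t j ^ k)" for j
  \<comment> \<open>A nonnegative weight of mean 1 that picks out \<open>|h 0| + |h m| / 2\<close> from \<open>c T\<close>.\<close>
  define W where "W j = 1 + Re (\<mu> * cnj (t j ^ m))" for j
  have sum_T: "(\<Sum>j<N. T j * (t j ^ a * cnj (t j ^ b))) =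
      (\<Sum>k\<le>K. h k * (if k + a = b then of_nat N else 0))" if "a \<le> m" "b \<le> m" for a b
  proof -
    have "(\<Sum>j<N. T j * (t j ^ a * cnj (t j ^ b))) =
        (\<Sum>k\<le>K. h k * (\<Sum>j<N. t j ^ (k + a) * cnj (t j ^ b)))"
      unfolding T_def sum_distrib_right sum_distrib_left
      by (subst sum.swap) (simp add: power_add mult.assoc)
    also have "\<dots> = (\<Sum>k\<le>K. h k * (if k + a = b then of_nat N else 0))"
      unfolding t_def using that
      by (intro sum.cong refl arg_cong2[where f="(*)"] sum_root_pt) (auto simp: N_def)
    finally show ?thesis .
  qed
  have W0: "W j \<ge> 0" for j
  proof -
    have "cmod (\<mu> * cnj (t j ^ m)) = 1" by (simp add: norm_mult norm_power \<mu> t_def)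
    then show ?thesis using abs_Re_le_cmod[of "\<mu> * cnj (t j ^ m)"] by (simp add: W_def)
  qed
  have "(\<Sum>j<N. t j ^ 0 * cnj (t j ^ m)) = 0"
    unfolding t_def using m by (subst sum_root_pt) (auto simp: N_def)
  then have "\<mu> * (\<Sum>j<N. cnj (t j ^ m)) = 0" by simp
  then have "Re (\<Sum>j<N. \<mu> * cnj (t j ^ m)) = 0" by (simp only: sum_distrib_left zero_complex.sel)
  then have W_sum: "(\<Sum>j<N. W j) = real N" by (simp add: W_def sum.distrib)
  have W_eq: "complex_of_real (W j) =
      t j ^ 0 * cnj (t j ^ 0) + (\<mu> / 2) * (t j ^ 0 * cnj (t j ^ m)) + (cnj \<mu> / 2) * (t j ^ m * cnj (t j ^ 0))" for j
  proof -
    have "complex_of_real (Re (\<mu> * cnj (t j ^ m))) = (\<mu> * cnj (t j ^ m) + cnj (\<mu> * cnj (t j ^ m))) / 2"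
      by (simp only: complex_add_cnj) simp
    then show ?thesis by (simp only: W_def of_real_add of_real_1) (simp add: add_divide_distrib)
  qed
  have "(\<Sum>j<N. c * T j * of_real (W j)) =
     c * (\<Sum>j<N. T j * (t j ^ 0 * cnj (t j ^ 0))) +
     c * (\<mu> / 2) * (\<Sum>j<N. T j * (t j ^ 0 * cnj (t j ^ m))) +
     c * (cnj \<mu> / 2) * (\<Sum>j<N. T j * (t j ^ m * cnj (t j ^ 0)))"
    unfolding W_eq sum_distrib_left by (simp add: sum.distrib algebra_simps)
  \<comment> \<open>The constant part of \<open>W\<close> selects \<open>h 0\<close>, its conjugate
    power \<open>h m\<close>; the third sum vanishes because k + m = 0 is impossible for
    \<open>m \<ge> 1\<close>.\<close>
  also have "\<dots> = c * (of_nat N * h 0) + c * (\<mu> / 2) * (of_nat N * h m)"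
    using m by (subst (1 2 3) sum_T) (auto simp: if_distrib[of "\<lambda>x. h _ * x"] cong: if_cong)
  also have "\<dots> = of_nat N * (c * h 0 + \<mu> * (c * h m) / 2)" by (simp add: algebra_simps)
  also have "\<dots> = of_real (real N * (cmod (h 0) + cmod (h m) / 2))"
    unfolding c \<mu> by (simp add: norm_mult c)
  finally have "real N * (cmod (h 0) + cmod (h m) / 2) = cmod (\<Sum>j<N. c * T j * of_real (W j))"
    by (simp only: norm_of_real) simp
  also have "\<dots> \<le> (\<Sum>j<N. B * W j)"
    by (rule sum_norm_le)
       (use W0 bound in \<open>auto simp: norm_mult c T_def t_def intro!: mult_right_mono\<close>)
  also have "\<dots> = real N * B" by (simp add: W_sum mult.commute flip: sum_distrib_left)
  finally have "cmod (h 0) + cmod (h m) / 2 \<le> B" by (simp add: N_def del: of_nat_Suc)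
  then show ?thesis by simp
qed

section \<open>Truncating the monomial expansion by degree\<close>

definition low_indices :: "nat \<Rightarrow> nat \<Rightarrow> (nat \<Rightarrow> nat) set" where
  "low_indices n K = (\<Union>m\<le>K. hom_indices n m)"

lemma finite_low_indices [simp]: "finite (low_indices n K)"
  by (simp add: low_indices_def)

lemma low_indices_subset: "low_indices n K \<subseteq> multi_indices n"
  using hom_indices_subset by (auto simp: low_indices_def)

lemma sum_low_indices: "(\<Sum>\<alpha>\<in>low_indices n K. g \<alpha>) = (\<Sum>m\<le>K. \<Sum>\<alpha>\<in>hom_indices n m. g \<alpha>)"
  unfolding low_indices_def by (rule sum.UNION_disjoint) (simp, simp, auto simp: hom_indices_def)

lemma finite_subset_low_indices:
  assumes "finite F" "F \<subseteq> multi_indices n"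
  obtains K where "m \<le> K" "F \<subseteq> low_indices n K"
proof
  define K where "K = Max (insert m ((\<lambda>\<alpha>. \<Sum>k<n. \<alpha> k) ` F))"
  show "m \<le> K" using assms by (simp add: K_def)
  show "F \<subseteq> low_indices n K"
  proof
    fix \<alpha> assume "\<alpha> \<in> F"
    then have "(\<Sum>k<n. \<alpha> k) \<le> K" using assms by (auto simp: K_def intro: Max_ge)
    then show "\<alpha> \<in> low_indices n K"
      using \<open>\<alpha> \<in> F\<close> assms by (auto simp: low_indices_def hom_indices_def)
  qed
qed

text \<open>The moduli of the terms do not change as \<open>t\<close> runs over the unit circle, so
  one finite set of multi-indices controls the tails uniformly in \<open>t\<close>.\<close>

lemma monomial_expansion_truncate:
  assumes exp: "monomial_expansion n a f U" and z: "\<And>t. cmod t = 1 \<Longrightarrow> (\<lambda>k. t * z k) \<in> U"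
    and "\<epsilon> > 0"
  obtains K where "m \<le> K"
    "\<And>t. cmod t = 1 \<Longrightarrow> cmod (f (\<lambda>k. t * z k) - (\<Sum>k\<le>K. hpoly n k a z * t ^ k)) \<le> \<epsilon>"
proof -
  let ?I = "multi_indices n"
  define b where "b t \<alpha> = a \<alpha> * monomial n \<alpha> (\<lambda>k. t * z k)" for t \<alpha>
  have hs: "(b t has_sum f (\<lambda>k. t * z k)) ?I" if "cmod t = 1" for t
    using bspec[OF exp[unfolded monomial_expansion_def] z[OF that]] unfolding b_def .
  have nb: "cmod (b t \<alpha>) = cmod (b 1 \<alpha>)" if "cmod t = 1" for t \<alpha>
    using that by (simp add: b_def norm_mult cmod_monomial)
  have "(\<lambda>\<alpha>. norm (b 1 \<alpha>)) summable_on ?I"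
    using hs[of 1] by (simp add: has_sum_imp_summable flip: summable_on_iff_abs_summable_on_complex)
  then obtain s where s: "((\<lambda>\<alpha>. norm (b 1 \<alpha>)) has_sum s) ?I" using summable_on_def by blast
  obtain F where F: "finite F" "F \<subseteq> ?I" "dist (\<Sum>\<alpha>\<in>F. norm (b 1 \<alpha>)) s \<le> \<epsilon>"
    using has_sum_finite_approximation[OF s \<open>\<epsilon> > 0\<close>] by blast
  obtain K where K: "m \<le> K" "F \<subseteq> low_indices n K"
    using finite_subset_low_indices[OF F(1,2)] by blast
  let ?D = "low_indices n K"
  have "cmod (f (\<lambda>k. t * z k) - (\<Sum>k\<le>K. hpoly n k a z * t ^ k)) \<le> \<epsilon>" if t: "cmod t = 1" for t
  proof -
    have "(\<Sum>\<alpha>\<in>?D. b t \<alpha>) = (\<Sum>k\<le>K. hpoly n k a z * t ^ k)"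
      unfolding sum_low_indices b_def hpoly_def sum_distrib_right
      by (intro sum.cong refl) (simp add: monomial_scale mult_ac)
    then have 1: "(b t has_sum (f (\<lambda>k. t * z k) - (\<Sum>k\<le>K. hpoly n k a z * t ^ k))) (?I - ?D)"
      using has_sum_Diff[OF hs[OF t] has_sum_finite[of ?D "b t"] low_indices_subset] by simp
    have 2: "((\<lambda>\<alpha>. norm (b t \<alpha>)) has_sum (s - (\<Sum>\<alpha>\<in>?D. norm (b 1 \<alpha>)))) (?I - ?D)"
      unfolding nb[OF t] by (rule has_sum_Diff[OF s has_sum_finite low_indices_subset]) simp
    have "cmod (f (\<lambda>k. t * z k) - (\<Sum>k\<le>K. hpoly n k a z * t ^ k)) \<le> s - (\<Sum>\<alpha>\<in>?D. norm (b 1 \<alpha>))"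
      by (rule norm_has_sum_bound[OF 2 1])
    also have "\<dots> \<le> s - (\<Sum>\<alpha>\<in>F. norm (b 1 \<alpha>))"
      using sum_mono2[OF finite_low_indices K(2), of "\<lambda>\<alpha>. norm (b 1 \<alpha>)"] by simp
    also have "\<dots> \<le> \<epsilon>" using F(3) by (simp add: dist_real_def)
    finally show ?thesis .
  qed
  with K(1) that show ?thesis by blast
qed

lemma hpoly_0: "hpoly n 0 a z = a (\<lambda>_. 0)"
  by (simp add: hpoly_def hom_indices_0 monomial_def)

text \<open>On the circle through \<open>z\<close> the truncated expansion is a polynomial in
  \<open>t\<close> with coefficients \<open>hpoly n k a z\<close>, bounded by M + e/2;
  Caratheodory's inequality applies, and e is arbitrary.\<close>

lemma homogeneous_part_bound:
  assumes exp: "monomial_expansion n a f U" and z: "\<And>t. cmod t = 1 \<Longrightarrow> (\<lambda>k. t * z k) \<in> U"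
    and bound: "\<And>w. w \<in> U \<Longrightarrow> cmod (f w) \<le> M" and "1 \<le> m"
  shows "cmod (hpoly n m a z) \<le> 2 * (M - cmod (a (\<lambda>_. 0)))"
proof (rule field_le_epsilon)
  fix e :: real assume "e > 0"
  then obtain K where K: "m \<le> K"
    "\<And>t. cmod t = 1 \<Longrightarrow> cmod (f (\<lambda>k. t * z k) - (\<Sum>k\<le>K. hpoly n k a z * t ^ k)) \<le> e / 2"
    using monomial_expansion_truncate[OF exp z, of "e / 2"] by (metis half_gt_zero)
  have "cmod (hpoly n m a z) \<le> 2 * (M + e / 2 - cmod (hpoly n 0 a z))"
  proof (rule polynomial_caratheodory[where K = K and h = "\<lambda>k. hpoly n k a z"])
    fix t :: complex assume t: "cmod t = 1"
    show "cmod (\<Sum>k\<le>K. hpoly n k a z * t ^ k) \<le> M + e / 2"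
      using K(2)[OF t] bound[OF z[OF t]] norm_triangle_ineq3[of "f (\<lambda>k. t * z k)" "\<Sum>k\<le>K. hpoly n k a z * t ^ k"]
      by linarith
  qed (use K \<open>1 \<le> m\<close> in auto)
  then show "cmod (hpoly n m a z) \<le> 2 * (M - cmod (a (\<lambda>_. 0))) + e" by (simp add: hpoly_0)
qed

text \<open>With M = sup |f| and a0 = |f(0)|, degree m >= 1 contributes at most 2 (M - a0) / 3^m.
  These bounds sum to M - a0, and the constant term restores a0. If the supremum is infinite there
  is nothing to prove.\<close>

lemma bohr_inequality:
  fixes G :: "nat \<Rightarrow> real"
  assumes exp: "monomial_expansion n a f U"
    and circled: "\<And>z t. z \<in> U \<Longrightarrow> cmod t = 1 \<Longrightarrow> (\<lambda>k. t * z k) \<in> U"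
    and core: "\<And>q c S u. (\<And>v. v \<in> U \<Longrightarrow> cmod (hpoly n (Suc q) c v) \<le> S) \<Longrightarrow> u \<in> U \<Longrightarrow>
       (\<Sum>\<alpha>\<in>hom_indices n (Suc q). cmod (c \<alpha> * monomial n \<alpha> u)) \<le> G q * S"
    and r: "0 \<le> r" "\<And>q. r ^ Suc q * G q \<le> (1 / 3) ^ Suc q"
  shows "(SUP z\<in>(\<lambda>z k. of_real r * z k) ` U.
           \<Sum>\<^sub>\<infinity>\<alpha>\<in>multi_indices n. ennreal (cmod (a \<alpha> * monomial n \<alpha> z)))
        \<le> (SUP z\<in>U. ennreal (cmod (f z)))" (is "_ \<le> ?R")
proof (cases "?R = top")
  case False
  define M where "M = enn2real ?R"
  have R: "?R = ennreal M"
    unfolding M_def using False by (intro ennreal_enn2real[symmetric]) (simp only: less_top)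
  have M: "cmod (f w) \<le> M" if "w \<in> U" for w
  proof -
    have "ennreal (cmod (f w)) \<le> ennreal M" unfolding R[symmetric] using that by (rule SUP_upper)
    moreover have "0 \<le> M" unfolding M_def by (rule enn2real_nonneg)
    ultimately show ?thesis by (simp only: ennreal_le_iff)
  qed
  have "(\<Sum>\<^sub>\<infinity>\<alpha>\<in>multi_indices n. ennreal (cmod (a \<alpha> * monomial n \<alpha> (\<lambda>k. of_real r * z k)))) \<le> ?R"
    if z: "z \<in> U" for z
  proof (rule infsum_le_finite_sums)
    define a0 where "a0 = cmod (a (\<lambda>_. 0))"
    define A where "A m = (\<Sum>\<alpha>\<in>hom_indices n m. cmod (a \<alpha> * monomial n \<alpha> z))" for m
    have part: "cmod (hpoly n (Suc q) a v) \<le> 2 * (M - a0)" if "v \<in> U" for v q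
      unfolding a0_def using homogeneous_part_bound[OF exp circled[OF that] M] by simp
    have a0: "a0 \<le> M" using order_trans[OF norm_ge_zero part[OF z, of 0]] by simp
    \<comment> \<open>The sum of 2 / 3^m over m = 1, ..., K is 1 - 3^(-K).\<close>
    have sums: "(\<Sum>m\<le>K. r ^ m * A m) \<le> a0 + (M - a0) * (1 - (1 / 3) ^ K)" for K
    proof (induction K)
      case 0
      then show ?case by (simp add: A_def hom_indices_0 monomial_def a0_def)
    next
      case (Suc K)
      have "r ^ Suc K * A (Suc K) \<le> r ^ Suc K * (G K * (2 * (M - a0)))"
        unfolding A_def using r(1) by (intro mult_left_mono core part z) auto
      also have "\<dots> \<le> (1 / 3) ^ Suc K * (2 * (M - a0))"
        using mult_right_mono[OF r(2)[of K], of "2 * (M - a0)"] a0 by (simp add: mult.assoc)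
      also have "\<dots> = (M - a0) * (1 - (1 / 3) ^ Suc K) - (M - a0) * (1 - (1 / 3) ^ K)"
      proof -
        have "1 / 3 * x * (2 * d) = d * (1 - 1 / 3 * x) - d * (1 - x)" for x d :: real
          by (simp add: field_simps)
        then show ?thesis unfolding power_Suc .
      qed
      finally show ?case using Suc unfolding sum.atMost_Suc by linarith
    qed
    fix F assume F: "finite F" "F \<subseteq> multi_indices n"
    obtain K where K: "F \<subseteq> low_indices n K" using finite_subset_low_indices[OF F] by blast
    let ?g = "\<lambda>\<alpha>. cmod (a \<alpha> * monomial n \<alpha> (\<lambda>k. of_real r * z k))"
    have "(\<Sum>\<alpha>\<in>F. ?g \<alpha>) \<le> (\<Sum>\<alpha>\<in>low_indices n K. ?g \<alpha>)" by (rule sum_mono2) (use K in auto)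
    also have "\<dots> = (\<Sum>m\<le>K. r ^ m * A m)"
      unfolding sum_low_indices A_def sum_distrib_left
      by (intro sum.cong refl) (use r(1) in \<open>simp add: monomial_scale norm_mult norm_power mult_ac\<close>)
    also have "\<dots> \<le> a0 + (M - a0) * (1 - (1 / 3) ^ K)" by (rule sums)
    also have "\<dots> \<le> a0 + (M - a0) * 1" using a0 by (intro add_left_mono mult_left_mono) auto
    finally show "(\<Sum>\<alpha>\<in>F. ennreal (?g \<alpha>)) \<le> ?R" unfolding R by (simp add: sum_ennreal ennreal_leI)
  qed (simp add: nonneg_summable_on_complete)
  then show ?thesis by (intro SUP_least) blast
qed (simp only: top_greatest)

section \<open>The unit ball of the p-norm\<close>

lemma lp_unit_ball_iff:
  assumes "1 \<le> p" "1 \<le> n"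
  shows "z \<in> unit_ball n (lp_norm p n) \<longleftrightarrow> z \<in> cspace n \<and>
    (if p = \<infinity> then \<forall>k<n. cmod (z k) < 1 else (\<Sum>k<n. cmod (z k) powr real_of_ereal p) < 1)"
proof (cases "p = \<infinity>")
  case True
  have "(\<lambda>k. cmod (z k)) ` {..<n} \<noteq> {}" using assms by (simp add: lessThan_empty_iff)
  then show ?thesis by (auto simp: unit_ball_def lp_norm_def True Max_less_iff)
next
  case False
  define P where "P = real_of_ereal p"
  have P: "1 \<le> P" using assms False by (cases p) (auto simp: P_def)
  define s where "s = (\<Sum>k<n. cmod (z k) powr P)"
  have s: "0 \<le> s" by (simp add: s_def sum_nonneg)
  have "s powr (1 / P) < 1 \<longleftrightarrow> s < 1"
    using powr_less_mono2[of "1 / P" s 1] powr_mono2[of "1 / P" 1 s] s P by fastforce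
  then show ?thesis using False by (simp add: unit_ball_def lp_norm_def s_def P_def)
qed

text \<open>Gives both invariance under rotations and, for each point of the ball, a closed polydisc
  through it inside the ball.\<close>

lemma lp_unit_ball_solid:
  assumes "1 \<le> p" "1 \<le> n" "z \<in> unit_ball n (lp_norm p n)" "\<And>k. k < n \<Longrightarrow> cmod (w k) \<le> cmod (z k)"
    "w \<in> cspace n"
  shows "w \<in> unit_ball n (lp_norm p n)"
proof (cases "p = \<infinity>")
  case True
  with assms show ?thesis by (force simp: lp_unit_ball_iff intro: le_less_trans)
next
  case False
  then have "1 \<le> real_of_ereal p" using assms(1) by (cases p) auto
  then have "(\<Sum>k<n. cmod (w k) powr real_of_ereal p) \<le> (\<Sum>k<n. cmod (z k) powr real_of_ereal p)"
    using assms(4) by (intro sum_mono powr_mono2) auto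
  with assms False show ?thesis by (auto simp: lp_unit_ball_iff)
qed

text \<open>Multiplication by \<open>u\<close> maps the closed polydisc into \<open>U\<close>, and
  the pulled back polynomial has coefficients
  \<open>c \<alpha> * monomial n \<alpha> u\<close>.\<close>

lemma solid_coefficient_sum:
  assumes solid: "\<And>w. w \<in> cspace n \<Longrightarrow> (\<And>k. k < n \<Longrightarrow> cmod (w k) \<le> cmod (u k)) \<Longrightarrow> w \<in> U"
    and bound: "\<And>v. v \<in> U \<Longrightarrow> cmod (hpoly n (Suc q) c v) \<le> S"
  shows "(\<Sum>\<alpha>\<in>hom_indices n (Suc q). cmod (c \<alpha> * monomial n \<alpha> u))
       \<le> exp (real (Suc q)) * card (hom_indices n q) powr (1 / 2) * S"
proof -
  have "(\<Sum>\<alpha>\<in>hom_indices n (Suc q). cmod (c \<alpha> * monomial n \<alpha> u))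
      \<le> exp (real (Suc q)) * sqrt (card (hom_indices n q)) * S"
  proof (rule polydisc_coefficient_sum)
    fix v :: "nat \<Rightarrow> complex" assume v: "\<And>k. k < n \<Longrightarrow> cmod (v k) \<le> 1"
    \<comment> \<open>Cut off at \<open>n\<close> to lie in \<open>cspace n\<close>;
      \<open>hpoly\<close> does not see the difference.\<close>
    let ?w = "\<lambda>k. if k < n then u k * v k else 0"
    have "?w \<in> U"
      by (rule solid) (use v in \<open>auto simp: cspace_def norm_mult mult_left_le\<close>)
    moreover have "hpoly n (Suc q) (\<lambda>\<alpha>. c \<alpha> * monomial n \<alpha> u) v = hpoly n (Suc q) c (\<lambda>k. u k * v k)"
      by (simp add: hpoly_def monomial_mult mult_ac)
    moreover have "hpoly n (Suc q) c (\<lambda>k. u k * v k) = hpoly n (Suc q) c ?w"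
      by (rule hpoly_cong) simp
    ultimately show "cmod (hpoly n (Suc q) (\<lambda>\<alpha>. c \<alpha> * monomial n \<alpha> u) v) \<le> S"
      using bound by simp
  qed
  then show ?thesis by (simp add: powr_half_sqrt)
qed

text \<open>Shrinking a point of the closed ball by t < 1 moves it into the open ball and costs
  t^(q+1) by homogeneity; t is the root that makes this cost an arbitrary x < 1.\<close>

lemma lp_ball_closed_bound:
  assumes p: "1 \<le> p" "p \<noteq> \<infinity>" and n: "1 \<le> n"
    and bound: "\<And>v. v \<in> unit_ball n (lp_norm p n) \<Longrightarrow> cmod (hpoly n (Suc q) c v) \<le> S"
    and v: "(\<Sum>k<n. cmod (v k) powr real_of_ereal p) \<le> 1"
  shows "cmod (hpoly n (Suc q) c v) \<le> S"
proof (rule field_le_mult_one_interval)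
  fix x :: real assume x: "0 < x" "x < 1"
  define P where "P = real_of_ereal p"
  have P: "1 \<le> P" using p by (cases p) (auto simp: P_def)
  define t where "t = root (Suc q) x"
  have t: "0 < t" "t < 1" and tx: "t ^ Suc q = x"
    using x by (auto simp: t_def real_root_pow_pos2 simp del: power_Suc)
  let ?w = "\<lambda>k. if k < n then of_real t * v k else 0"
  have "t powr P < 1" using t P powr_less_mono2[of P t 1] by simp
  moreover have "(\<Sum>k<n. cmod (?w k) powr P) = t powr P * (\<Sum>k<n. cmod (v k) powr P)"
    using t by (simp add: norm_mult powr_mult sum_distrib_left)
  ultimately have "(\<Sum>k<n. cmod (?w k) powr P) < 1"
    using v mult_left_mono[of "\<Sum>k<n. cmod (v k) powr P" 1 "t powr P"] by (simp add: P_def)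
  then have "?w \<in> unit_ball n (lp_norm p n)"
    using p n by (simp add: lp_unit_ball_iff cspace_def P_def)
  then have "cmod (hpoly n (Suc q) c ?w) \<le> S" by (rule bound)
  also have "hpoly n (Suc q) c ?w = hpoly n (Suc q) c (\<lambda>k. of_real t * v k)"
    by (rule hpoly_cong) simp
  finally show "x * cmod (hpoly n (Suc q) c v) \<le> S"
    using t tx unfolding hpoly_scale norm_mult norm_power by simp
qed

lemma lp_ball_coefficient_sum:
  assumes "1 \<le> p" "1 \<le> n"
    and bound: "\<And>v. v \<in> unit_ball n (lp_norm p n) \<Longrightarrow> cmod (hpoly n (Suc q) c v) \<le> S"
    and u: "u \<in> unit_ball n (lp_norm p n)"
  shows "(\<Sum>\<alpha>\<in>hom_indices n (Suc q). cmod (c \<alpha> * monomial n \<alpha> u))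
       \<le> exp (real (Suc q)) * card (hom_indices n q) powr (1 - 1 / real_of_ereal (min p 2)) * S"
proof (cases "p \<le> 2")
  case True
  then have fin: "p \<noteq> \<infinity>" and P: "1 \<le> real_of_ereal p" using assms(1) by (cases p; auto)+
  have "(\<Sum>k<n. cmod (u k) powr real_of_ereal p) \<le> 1"
    using u assms(1,2) fin by (simp add: lp_unit_ball_iff)
  from lp_coefficient_sum[OF P lp_ball_closed_bound[OF assms(1) fin assms(2) bound] this]
  show ?thesis using True by (simp add: min_absorb1)
next
  case False
  then have "real_of_ereal (min p 2) = 2" by (simp add: min_def)
  then show ?thesis
    using solid_coefficient_sum[OF lp_unit_ball_solid[OF assms(1,2) u] bound] by simp
qed

text \<open>A real \<open>Sup\<close> is an upper bound only for a set bounded above. Testing with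
  the first coordinate at half the first unit vector gives r/2 <= 1, a crude but sufficient
  bound.\<close>

lemma bohr_set_bdd_above:
  assumes "1 \<le> p" "1 \<le> n"
  defines "U \<equiv> unit_ball n (lp_norm p n)"
  shows "bdd_above {r. 0 \<le> r \<and>
     (\<forall>f a. holomorphic_Cn n (lp_norm p n) f U \<and> monomial_expansion n a f U \<longrightarrow>
        (SUP z\<in>(\<lambda>z k. of_real r * z k) ` U.
           \<Sum>\<^sub>\<infinity>\<alpha>\<in>multi_indices n. ennreal (cmod (a \<alpha> * monomial n \<alpha> z)))
        \<le> (SUP z\<in>U. ennreal (cmod (f z))))}"
proof (rule bdd_aboveI)
  fix r assume r: "r \<in> {r. 0 \<le> r \<and>
     (\<forall>f a. holomorphic_Cn n (lp_norm p n) f U \<and> monomial_expansion n a f U \<longrightarrow>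
        (SUP z\<in>(\<lambda>z k. of_real r * z k) ` U.
           \<Sum>\<^sub>\<infinity>\<alpha>\<in>multi_indices n. ennreal (cmod (a \<alpha> * monomial n \<alpha> z)))
        \<le> (SUP z\<in>U. ennreal (cmod (f z))))}"
  define f where "f z = z 0" for z :: "nat \<Rightarrow> complex"
  define e where "e k = (if k = 0 then 1 else 0::nat)" for k :: nat
  define a where "a \<alpha> = (if \<alpha> = e then 1 else 0::complex)" for \<alpha>
  define z0 where "z0 k = (if k = 0 then 1 / 2 else 0::complex)" for k :: nat
  have e: "e \<in> multi_indices n" using assms by (auto simp: multi_indices_def e_def)
  have mon: "monomial n e z = z 0" for z
  proof -
    have "monomial n e z = (\<Prod>k<n. if k = 0 then z 0 else 1)"
      unfolding monomial_def by (intro prod.cong) (auto simp: e_def)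
    then show ?thesis using assms by simp
  qed
  have lt1: "cmod (z 0) \<le> 1" if "z \<in> U" for z
  proof (cases "p = \<infinity>")
    case True
    then show ?thesis using that assms lp_unit_ball_iff[of p n z] by (auto intro: less_imp_le)
  next
    case False
    then have P: "1 \<le> real_of_ereal p" using assms(1) by (cases p) auto
    show ?thesis
    proof (rule ccontr)
      assume "\<not> cmod (z 0) \<le> 1"
      then have "1 \<le> cmod (z 0) powr real_of_ereal p" using P by (intro ge_one_powr_ge_zero) auto
      also have "\<dots> \<le> (\<Sum>k<n. cmod (z k) powr real_of_ereal p)"
        using assms by (intro member_le_sum) auto
      finally show False using that assms False lp_unit_ball_iff[of p n z] by simp
    qed
  qed
  have "(\<Sum>k<n. cmod (z0 k) powr real_of_ereal p) = (1 / 2) powr real_of_ereal p"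
  proof -
    have "(\<Sum>k<n. cmod (z0 k) powr real_of_ereal p) = (\<Sum>k<n. if k = 0 then (1 / 2) powr real_of_ereal p else 0)"
      by (intro sum.cong) (auto simp: z0_def norm_divide)
    then show ?thesis using assms by simp
  qed
  moreover have "(1 / 2 :: real) powr real_of_ereal p < 1" if "p \<noteq> \<infinity>"
    using that assms(1) powr_less_mono2[of "real_of_ereal p" "1 / 2" 1] by (cases p) auto
  ultimately have z0: "z0 \<in> U"
    using assms by (auto simp: U_def lp_unit_ball_iff cspace_def z0_def norm_divide)
  have "holomorphic_Cn n (lp_norm p n) f U"
    unfolding holomorphic_Cn_def
  proof (intro ballI exI allI impI conjI)
    fix z h :: "nat \<Rightarrow> complex" and \<epsilon> :: real assume "\<epsilon> > 0"
    \<comment> \<open>A linear function is its own derivative with remainder 0, so any radius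
      serves.\<close>
    show "(1::real) > 0" by simp
    have "(\<Sum>k<n. of_nat (e k) * h k) = (\<Sum>k<n. if k = 0 then h 0 else 0)"
      by (intro sum.cong) (auto simp: e_def)
    then have "f (\<lambda>k. z k + h k) - f z - (\<Sum>k<n. of_nat (e k) * h k) = 0"
      using assms by (simp add: f_def)
    moreover have "0 \<le> lp_norm p n h"
    proof -
      have "cmod (h 0) \<le> Max ((\<lambda>k. cmod (h k)) ` {..<n})"
        using assms by (intro Max_ge) auto
      then show ?thesis by (simp add: lp_norm_def order_trans[OF norm_ge_zero])
    qed
    ultimately show "cmod (f (\<lambda>k. z k + h k) - f z - (\<Sum>k<n. of_nat (e k) * h k)) \<le> \<epsilon> * lp_norm p n h"
      using \<open>\<epsilon> > 0\<close> by simp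
  qed
  moreover have "monomial_expansion n a f U"
    unfolding monomial_expansion_def
    by (intro ballI has_sum_finite_neutralI[of "{e}"]) (use e in \<open>auto simp: a_def f_def mon\<close>)
  ultimately have *: "(SUP z\<in>(\<lambda>z k. of_real r * z k) ` U.
           \<Sum>\<^sub>\<infinity>\<alpha>\<in>multi_indices n. ennreal (cmod (a \<alpha> * monomial n \<alpha> z)))
        \<le> (SUP z\<in>U. ennreal (cmod (f z)))"
    using r by blast
  let ?z = "\<lambda>k. of_real r * z0 k"
  have "ennreal (r / 2) = (\<Sum>\<^sub>\<infinity>\<alpha>\<in>{e}. ennreal (cmod (a \<alpha> * monomial n \<alpha> ?z)))"
    using r by (simp add: a_def mon z0_def norm_divide)
  also have "\<dots> \<le> (\<Sum>\<^sub>\<infinity>\<alpha>\<in>multi_indices n. ennreal (cmod (a \<alpha> * monomial n \<alpha> ?z)))"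
    by (rule infsum_mono_neutral) (use e in \<open>auto intro: nonneg_summable_on_complete\<close>)
  also have "\<dots> \<le> (SUP z\<in>(\<lambda>z k. of_real r * z k) ` U.
           \<Sum>\<^sub>\<infinity>\<alpha>\<in>multi_indices n. ennreal (cmod (a \<alpha> * monomial n \<alpha> z)))"
    using z0 by (intro SUP_upper) auto
  also note *
  also have "(SUP z\<in>U. ennreal (cmod (f z))) \<le> ennreal 1"
    by (intro SUP_least ennreal_leI) (use lt1 in \<open>auto simp: f_def\<close>)
  finally show "r \<le> 2" by (simp add: ennreal_le_iff)
qed

text \<open>The counting estimate raised to the power \<open>\<sigma>\<close>;
  \<open>\<sigma> \<le> 1\<close> keeps the constant 4. The case \<open>\<sigma> = 0\<close> is
  separate because there \<open>rpow\<close> is 1 even at base 0.\<close>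

lemma rpow_power_mult_card_le:
  assumes "1 \<le> n" "0 \<le> \<sigma>" "\<sigma> \<le> 1"
  shows "rpow (ln (real n) / real n) \<sigma> ^ Suc q * card (hom_indices n q) powr \<sigma> \<le> 4 ^ Suc q"
proof (cases "\<sigma> = 0")
  case True
  have "card (hom_indices n q) powr 0 \<le> (1::real)" by simp
  also have "(1::real) \<le> 4 ^ Suc q" by (rule one_le_power) simp
  finally show ?thesis by (simp add: True rpow_def del: power_Suc)
next
  case False
  define L where "L = ln (real n) / real n"
  have L: "0 \<le> L" using assms by (simp add: L_def)
  have "(L powr \<sigma>) ^ m = (L ^ m) powr \<sigma>" for m using L by (induction m) (auto simp: powr_mult)
  then have "rpow L \<sigma> ^ Suc q * card (hom_indices n q) powr \<sigma>
      = (L ^ Suc q * card (hom_indices n q)) powr \<sigma>"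
    using L False by (simp add: rpow_def powr_mult del: power_Suc)
  also have "\<dots> \<le> (4 ^ Suc q) powr \<sigma>"
    using card_hom_indices_log[OF assms(1), of q] L assms by (intro powr_mono2) (auto simp: L_def)
  also have "\<dots> \<le> (4 ^ Suc q) powr 1"
    using assms by (intro powr_mono one_le_power) auto
  finally show ?thesis by (simp add: L_def)
qed

theorem theorem1p3:
  "\<exists>C::real. C > 0 \<and>
     (\<forall>(p::ereal) (n::nat). 1 \<le> p \<and> 1 \<le> n \<longrightarrow>
        (1 / C) * rpow (ln (real n) / real n) (1 - 1 / real_of_ereal (min p 2))
          \<le> bohr_radius n (lp_norm p n))"
proof (intro exI[of _ 36] conjI allI impI)
  fix p :: ereal and n :: nat
  assume "1 \<le> p \<and> 1 \<le> n"
  then have p: "1 \<le> p" and n: "1 \<le> n" by auto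
  let ?U = "unit_ball n (lp_norm p n)"
  define \<sigma> where "\<sigma> = 1 - 1 / real_of_ereal (min p 2)"
  have "1 \<le> real_of_ereal (min p 2)" using p by (cases p) (auto simp: min_def)
  then have \<sigma>: "0 \<le> \<sigma>" "\<sigma> \<le> 1" by (auto simp: \<sigma>_def divide_le_eq)
  define R where "R = rpow (ln (real n) / real n) \<sigma>"
  have R: "0 \<le> R" by (simp add: R_def rpow_def)
  define G where "G q = exp (real (Suc q)) * card (hom_indices n q) powr \<sigma>" for q
  \<comment> \<open>36 = 3 * 4 * 3: the first 3 bounds e, the 4 comes from counting monomials, and
    the last 3 leaves the ratio 1/3 of the geometric series.\<close>
  have small: "(1 / 36 * R) ^ Suc q * G q \<le> (1 / 3) ^ Suc q" for q
  proof -
    have "exp (real (Suc q)) = exp 1 ^ Suc q" using exp_of_nat_mult[of "Suc q" "1::real"] by simp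
    also have "\<dots> \<le> (3::real) ^ Suc q" by (intro power_mono exp_le) auto
    finally have e: "exp (real (Suc q)) \<le> 3 ^ Suc q" .
    have "(1 / 36 * R) ^ Suc q * G q
        = (1 / 36) ^ Suc q * (exp (real (Suc q)) * (R ^ Suc q * card (hom_indices n q) powr \<sigma>))"
      unfolding G_def power_mult_distrib by (simp only: mult_ac)
    also have "\<dots> \<le> (1 / 36) ^ Suc q * (3 ^ Suc q * 4 ^ Suc q)"
      unfolding R_def using n \<sigma> R[unfolded R_def]
      by (intro mult_left_mono mult_mono e rpow_power_mult_card_le) auto
    also have "\<dots> = (1 / 3) ^ Suc q" unfolding power_mult_distrib[symmetric] by simp
    finally show ?thesis .
  qed
  have circled: "(\<lambda>k. t * z k) \<in> ?U" if "z \<in> ?U" "cmod t = 1" for z t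
    by (rule lp_unit_ball_solid[OF p n that(1)])
       (use that in \<open>auto simp: norm_mult unit_ball_def cspace_def\<close>)
  show "1 / 36 * rpow (ln (real n) / real n) (1 - 1 / real_of_ereal (min p 2))
      \<le> bohr_radius n (lp_norm p n)"
    unfolding bohr_radius_def \<sigma>_def[symmetric] R_def[symmetric]
    by (intro cSup_upper bohr_set_bdd_above p n CollectI conjI allI impI
          bohr_inequality[where G = G] circled small)
       (use R lp_ball_coefficient_sum[OF p n] in \<open>auto simp: G_def \<sigma>_def\<close>)
qed simp

end
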